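(* Let $n\ge3$, let $\Omega\subset\mathbb{R}^n$ be a bounded domain with smooth boundary, let $u$ solve $\Delta u=-n$ in $\Omega$, $u=0$ on $\partial\Omega$, and let $N$ be a connected component of $\Omega\setminus\mathrm{MAX}(u)$. Then $\tau(u,N)\ge1$, and equality holds if and only if $(\Omega,u)$ is equivalent to the Serrin solution $\Omega_0=B_1(0)$, $u_0(x)=\frac{1-|x|^2}{2}$.
   Context: $u_{\max}=\max_\Omega u$, $\mathrm{MAX}(u)=\{x\in\Omega:u(x)=u_{\max}\}$. NWSS: for a connected component $S$ of $\partial\Omega$, $\tau(u,S)=\max_S|\nabla u|/\sqrt{2u_{\max}}$; $\tau(u,N)$ is the maximum of $\tau(u,S)$ over the connected components $S$ of $\partial\Omega\cap\overline N$ (a nonempty set). Equivalence: $\bar\Omega=\{\lambda x+c:x\in\Omega\}$, $\bar u(y)=\lambda^2u((y-c)/\lambda)$ for some $\lambda>0$, $c\in\mathbb{R}^n$. *)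

theory Defs
  imports "HOL-Analysis.Analysis"
begin

fun iter_dderiv :: "('a::real_normed_vector \<Rightarrow> real) \<Rightarrow> 'a list \<Rightarrow> ('a \<Rightarrow> real)" where
  "iter_dderiv f [] = f"
| "iter_dderiv f (v # vs) = (\<lambda>x. frechet_derivative (iter_dderiv f vs) (at x) v)"

definition smooth_fun :: "('a::real_normed_vector \<Rightarrow> real) \<Rightarrow> bool" where
  "smooth_fun f \<longleftrightarrow> (\<forall>vs x. iter_dderiv f vs differentiable (at x))"

definition smooth_bounded_domain :: "'a::euclidean_space set \<Rightarrow> bool" where
  "smooth_bounded_domain \<Omega> \<longleftrightarrow> open \<Omega> \<and> connected \<Omega> \<and> bounded \<Omega> \<and> \<Omega> \<noteq> {} \<and>
     (\<exists>\<rho>. smooth_fun \<rho> \<and> \<Omega> = {x. \<rho> x < 0} \<and>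
        (\<forall>x\<in>frontier \<Omega>. frechet_derivative \<rho> (at x) \<noteq> (\<lambda>h. 0)))"

definition serrin_solution :: "'a::euclidean_space set \<Rightarrow> ('a \<Rightarrow> real) \<Rightarrow> ('a \<Rightarrow> 'a) \<Rightarrow> bool" where
  "serrin_solution \<Omega> u G \<longleftrightarrow>
     continuous_on (closure \<Omega>) u \<and> (\<forall>x\<in>frontier \<Omega>. u x = 0) \<and>
     continuous_on (closure \<Omega>) G \<and>
     (\<forall>x\<in>\<Omega>. (u has_derivative (\<lambda>h. G x \<bullet> h)) (at x)) \<and>
     (\<forall>x\<in>\<Omega>. G differentiable (at x)) \<and>
     (\<forall>b\<in>Basis. continuous_on \<Omega> (\<lambda>x. frechet_derivative G (at x) b)) \<and>
     (\<forall>x\<in>\<Omega>. (\<Sum>b\<in>Basis. frechet_derivative G (at x) b \<bullet> b) = - real DIM('a))"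

definition umax :: "'a set \<Rightarrow> ('a \<Rightarrow> real) \<Rightarrow> real" where
  "umax \<Omega> u = Sup (u ` \<Omega>)"

definition MAXset :: "'a set \<Rightarrow> ('a \<Rightarrow> real) \<Rightarrow> 'a set" where
  "MAXset \<Omega> u = {x\<in>\<Omega>. u x = umax \<Omega> u}"

text \<open>tau(u,S) for a boundary component S; G is the (continuously extended) gradient.\<close>
definition tau_comp :: "'a set \<Rightarrow> ('a \<Rightarrow> real) \<Rightarrow> ('a::euclidean_space \<Rightarrow> 'a) \<Rightarrow> 'a set \<Rightarrow> real" where
  "tau_comp \<Omega> u G S = Sup ((\<lambda>x. norm (G x)) ` S) / sqrt (2 * umax \<Omega> u)"

definition tau_region :: "'a set \<Rightarrow> ('a \<Rightarrow> real) \<Rightarrow> ('a::euclidean_space \<Rightarrow> 'a) \<Rightarrow> 'a set \<Rightarrow> real" where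
  "tau_region \<Omega> u G N = Sup ((\<lambda>S. tau_comp \<Omega> u G S) ` components (frontier \<Omega> \<inter> closure N))"

definition equiv_serrin :: "'a::euclidean_space set \<Rightarrow> ('a \<Rightarrow> real) \<Rightarrow> bool" where
  "equiv_serrin \<Omega> u \<longleftrightarrow> (\<exists>l::real. \<exists>c::'a. l > 0 \<and>
      \<Omega> = (\<lambda>x. l *\<^sub>R x + c) ` ball 0 1 \<and>
      (\<forall>y\<in>\<Omega>. u y = l\<^sup>2 * ((1 - (norm ((1 / l) *\<^sub>R (y - c)))\<^sup>2) / 2)))"

end

theory Submission
  imports Defs
begin

text \<open>
  The function \<open>P = |\<nabla>u|\<^sup>2 + 2 u\<close> satisfies \<open>\<Delta>P = 2 |D\<^sup>2u + I|\<^sup>2 \<ge> 0\<close>. If \<open>\<tau>(u,N) \<le> 1\<close>, then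
  \<open>P \<le> 2 u\<^sub>m\<^sub>a\<^sub>x\<close> on the frontier of \<open>N\<close>, hence on \<open>N\<close>. If the inequality were strict somewhere, a ball
  in \<open>{x \<in> N. P x < 2 u\<^sub>m\<^sub>a\<^sub>x}\<close> would touch the frontier of this set at a point of \<open>\<Omega>\<close> where
  \<open>P = 2 u\<^sub>m\<^sub>a\<^sub>x\<close> and \<open>\<nabla>P = 0\<close>: \<open>\<nabla>P = 2 (D\<^sup>2u + I) \<nabla>u\<close> vanishes on \<open>MAX(u)\<close> as well as at
  interior maxima of \<open>P\<close>. This contradicts the Hopf lemma. So \<open>P\<close> is constant on \<open>N\<close>, \<open>D\<^sup>2u = -I\<close>
  there, the frontier of \<open>N\<close> in \<open>\<Omega>\<close> is a single point, and \<open>\<Omega>\<close> is a ball.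

  As \<open>u\<close> is only assumed to be of class \<open>C\<^sup>2\<close>, the inequality for \<open>\<Delta>P\<close> is understood in the viscosity
  sense.
\<close>

section \<open>Second-order calculus with explicit gradients and Hessians\<close>

definition op_trace :: "('a::euclidean_space \<Rightarrow> 'a) \<Rightarrow> real" where
  "op_trace A = (\<Sum>b\<in>Basis. A b \<bullet> b)"

text \<open>\<open>F\<close> is the gradient and \<open>H x\<close> the Hessian as a linear map.
  Both are explicit arguments, so that Hessians of compound functions are assembled by composing
  rules and their traces computed afterwards. Only pointwise second differentiability is
  recorded.\<close>

definition hess_on ::
  "('a::euclidean_space \<Rightarrow> real) \<Rightarrow> ('a \<Rightarrow> 'a) \<Rightarrow> ('a \<Rightarrow> 'a \<Rightarrow> 'a) \<Rightarrow> 'a set \<Rightarrow> bool" where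
  "hess_on f F H S \<longleftrightarrow>
     (\<forall>x\<in>S. (f has_derivative (\<lambda>h. F x \<bullet> h)) (at x) \<and> (F has_derivative H x) (at x))"

lemma hess_on_subset: "hess_on f F H S \<Longrightarrow> T \<subseteq> S \<Longrightarrow> hess_on f F H T"
  unfolding hess_on_def by blast

lemma hess_on_continuous: "hess_on f F H S \<Longrightarrow> continuous_on S f"
  unfolding hess_on_def
  by (meson continuous_at_imp_continuous_on has_derivative_continuous)

lemma hess_on_add:
  assumes "hess_on f F H S" "hess_on g K L S"
  shows "hess_on (\<lambda>x. f x + g x) (\<lambda>x. F x + K x) (\<lambda>x h. H x h + L x h) S"
  using assms unfolding hess_on_def by (auto intro!: derivative_eq_intros simp: inner_add_left)

lemma hess_on_cmult:
  assumes "hess_on f F H S"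
  shows "hess_on (\<lambda>x. c * f x) (\<lambda>x. c *\<^sub>R F x) (\<lambda>x h. c *\<^sub>R H x h) S"
  using assms unfolding hess_on_def by (auto intro!: derivative_eq_intros)

lemma hess_on_sum:
  assumes "finite I" "\<And>i. i \<in> I \<Longrightarrow> hess_on (f i) (F i) (H i) S"
  shows "hess_on (\<lambda>x. \<Sum>i\<in>I. f i x) (\<lambda>x. \<Sum>i\<in>I. F i x) (\<lambda>x h. \<Sum>i\<in>I. H i x h) S"
  using assms
proof (induction I rule: finite_induct)
  case empty
  show ?case by (simp add: hess_on_def)
next
  case (insert i I)
  then show ?case using hess_on_add[of "f i" "F i" "H i" S] by simp
qed

lemma hess_on_square:
  assumes "hess_on f F H S"
  shows "hess_on (\<lambda>x. (f x)\<^sup>2) (\<lambda>x. (2 * f x) *\<^sub>R F x)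
           (\<lambda>x h. (2 * (F x \<bullet> h)) *\<^sub>R F x + (2 * f x) *\<^sub>R H x h) S"
  using assms unfolding hess_on_def
  by (auto intro!: derivative_eq_intros simp: algebra_simps)

lemma has_derivative_shift:
  assumes "(g has_derivative D) (at (x + a))"
  shows "((\<lambda>x. g (x + a)) has_derivative D) (at x)"
proof -
  have "((\<lambda>x. x + a) has_derivative (\<lambda>h. h)) (at x)"
    by (auto intro!: derivative_eq_intros)
  from has_derivative_compose[OF this assms] show ?thesis by simp
qed

lemma hess_on_shift:
  assumes "hess_on f F H T" "\<And>x. x \<in> S \<Longrightarrow> x + a \<in> T"
  shows "hess_on (\<lambda>x. f (x + a)) (\<lambda>x. F (x + a)) (\<lambda>x. H (x + a)) S"
  using assms unfolding hess_on_def by (auto intro!: has_derivative_shift)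

lemma has_real_derivative_along_line:
  fixes f :: "'a::real_normed_vector \<Rightarrow> real"
  assumes "(f has_derivative D) (at (x + t *\<^sub>R b))"
  shows "((\<lambda>s. f (x + s *\<^sub>R b)) has_real_derivative D b) (at t)"
proof -
  have "((\<lambda>s. x + s *\<^sub>R b) has_derivative (\<lambda>s. s *\<^sub>R b)) (at t)"
    by (auto intro!: derivative_eq_intros)
  from has_derivative_compose[OF this assms]
  have "((\<lambda>s. f (x + s *\<^sub>R b)) has_derivative (\<lambda>s. D (s *\<^sub>R b))) (at t)" .
  moreover have "(\<lambda>s. D (s *\<^sub>R b)) = (*) (D b)"
    using linear_scale[OF has_derivative_linear[OF assms]] by (auto simp: fun_eq_iff)
  ultimately show ?thesis by (simp add: has_field_derivative_def)
qed

text \<open>If \<open>H x b \<bullet> b\<close> were positive, the component of \<open>F\<close>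
  along \<open>b\<close> would be positive just beyond \<open>x\<close>, and the mean value theorem
  would push \<open>f\<close> above its maximum. So every diagonal entry of the Hessian is
  nonpositive, from differentiability of \<open>F\<close> at \<open>x\<close> alone.\<close>

lemma op_trace_hess_at_max:
  assumes hess: "hess_on f F H S" and "open S" "x \<in> S" and max: "\<And>y. y \<in> S \<Longrightarrow> f y \<le> f x"
  shows "op_trace (H x) \<le> 0"
proof -
  have "H x b \<bullet> b \<le> 0" if "b \<in> Basis" for b
  proof (rule ccontr)
    assume "\<not> H x b \<bullet> b \<le> 0"
    then have pos: "H x b \<bullet> b > 0" by simp
    have "(f has_derivative (\<lambda>h. F x \<bullet> h)) (at x)" and dF: "(F has_derivative H x) (at x)"
      using hess \<open>x \<in> S\<close> by (auto simp: hess_on_def)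
    then have "(\<lambda>h. F x \<bullet> h) = (\<lambda>h. 0)"
      using differential_zero_maxmin[OF \<open>x \<in> S\<close> \<open>open S\<close>] max by blast
    then have zero: "F x \<bullet> b = 0" by meson
    have "((\<lambda>y. F y \<bullet> b) has_derivative (\<lambda>h. H x h \<bullet> b)) (at (x + 0 *\<^sub>R b))"
      using dF by (auto intro!: derivative_eq_intros)
    from DERIV_pos_inc_right[OF has_real_derivative_along_line[OF this] pos]
    obtain d where "d > 0" and d: "\<And>h. 0 < h \<Longrightarrow> h < d \<Longrightarrow> 0 < F (x + h *\<^sub>R b) \<bullet> b"
      using zero by auto
    obtain e where "e > 0" and e: "ball x e \<subseteq> S"
      using \<open>open S\<close> \<open>x \<in> S\<close> open_contains_ball by blast
    define t where "t = min d e / 2"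
    have t: "0 < t" "t < d" "t < e" using \<open>d > 0\<close> \<open>e > 0\<close> by (auto simp: t_def)
    have inS: "x + s *\<^sub>R b \<in> S" if "0 \<le> s" "s \<le> t" for s
      using that t e \<open>b \<in> Basis\<close> by (intro subsetD[OF e]) (auto simp: dist_norm)
    have "\<exists>z>0. z < t \<and> f (x + t *\<^sub>R b) - f (x + 0 *\<^sub>R b) = (t - 0) * (F (x + z *\<^sub>R b) \<bullet> b)"
    proof (rule MVT2[OF \<open>0 < t\<close>])
      fix s :: real assume "0 \<le> s" "s \<le> t"
      with inS hess show "((\<lambda>s. f (x + s *\<^sub>R b)) has_real_derivative F (x + s *\<^sub>R b) \<bullet> b) (at s)"
        by (intro has_real_derivative_along_line) (auto simp: hess_on_def)
    qed
    then obtain z where z: "0 < z" "z < t" "f (x + t *\<^sub>R b) - f x = t * (F (x + z *\<^sub>R b) \<bullet> b)"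
      by auto
    have "0 < t * (F (x + z *\<^sub>R b) \<bullet> b)"
      using d[of z] z t by simp
    moreover have "f (x + t *\<^sub>R b) \<le> f x"
      using max inS t by simp
    ultimately show False using z by linarith
  qed
  then show ?thesis by (simp add: op_trace_def sum_nonpos)
qed

text \<open>The mean value inequality is applied to \<open>g\<close>, which is f along the segment
  minus its linear part; its derivative is small by uniform continuity of the directional derivative
  on a compact ball. Radius \<open>2 * r\<close> leaves room for shifts shorter than
  \<open>r\<close>. Values are vectors because both \<open>u\<close> and \<open>G\<close> are
  treated.\<close>

lemma difference_quotient_uniform:
  fixes f :: "'a::euclidean_space \<Rightarrow> 'b::real_normed_vector"
  assumes der: "\<And>x. x \<in> cball a (2 * r) \<Longrightarrow> (f has_derivative f' x) (at x)"
    and cont: "continuous_on (cball a (2 * r)) (\<lambda>x. f' x b)"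
    and "b \<in> Basis" "r > 0"
  shows "uniform_limit (cball a r) (\<lambda>h x. (1 / h) *\<^sub>R (f (x + h *\<^sub>R b) - f x)) (\<lambda>x. f' x b) (at_right 0)"
proof (rule uniform_limitI)
  fix e' :: real assume "e' > 0"
  \<comment> \<open>The mean value inequality yields a non-strict bound, so it is run with half of
    the tolerance.\<close>
  define e where "e = e' / 2"
  have e: "0 < e" "e < e'" using \<open>e' > 0\<close> by (auto simp: e_def)
  have "uniformly_continuous_on (cball a (2 * r)) (\<lambda>x. f' x b)"
    by (rule compact_uniformly_continuous[OF cont compact_cball])
  then obtain d where "d > 0" and d: "\<And>x y. x \<in> cball a (2 * r) \<Longrightarrow> y \<in> cball a (2 * r) \<Longrightarrow>
      dist y x < d \<Longrightarrow> dist (f' y b) (f' x b) < e"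
    using e unfolding uniformly_continuous_on_def by metis
  show "\<forall>\<^sub>F h in at_right 0. \<forall>x\<in>cball a r.
      dist ((1 / h) *\<^sub>R (f (x + h *\<^sub>R b) - f x)) (f' x b) < e'"
    unfolding eventually_at_right_field
  proof (intro exI[of _ "min d r"] conjI allI impI ballI)
    show "0 < min d r" using \<open>d > 0\<close> \<open>r > 0\<close> by simp
    fix h x assume h: "0 < h" "h < min d r" and x: "x \<in> cball a r"
    have mem: "x + s *\<^sub>R b \<in> cball a (2 * r)" if "0 \<le> s" "s \<le> h" for s
    proof -
      have "dist a (x + s *\<^sub>R b) \<le> dist a x + s"
        using dist_triangle[of a "x + s *\<^sub>R b" x] that \<open>b \<in> Basis\<close> by (simp add: dist_norm)
      then show ?thesis using x h that by simp
    qed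
    define g where "g = (\<lambda>s. f (x + s *\<^sub>R b) - s *\<^sub>R f' x b)"
    have "norm (g h - g 0) \<le> e * norm (h - 0)"
    proof (rule differentiable_bound[of "{0..h}" g "\<lambda>s t. t *\<^sub>R (f' (x + s *\<^sub>R b) b - f' x b)" e])
      fix s assume s: "s \<in> {0..h}"
      let ?D = "f' (x + s *\<^sub>R b)"
      have D: "(f has_derivative ?D) (at (x + s *\<^sub>R b))"
        using der mem s by simp
      have line: "((\<lambda>s. x + s *\<^sub>R b) has_derivative (\<lambda>s. s *\<^sub>R b)) (at s)"
        by (auto intro!: derivative_eq_intros)
      have "((\<lambda>s. f (x + s *\<^sub>R b)) has_derivative (\<lambda>t. t *\<^sub>R ?D b)) (at s)"
        using has_derivative_compose[OF line D] linear_scale[OF has_derivative_linear[OF D]] by simp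
      then have "(g has_derivative (\<lambda>t. t *\<^sub>R ?D b - t *\<^sub>R f' x b)) (at s)"
        unfolding g_def by (auto intro!: derivative_eq_intros)
      then show "(g has_derivative (\<lambda>t. t *\<^sub>R (?D b - f' x b))) (at s within {0..h})"
        by (simp add: has_derivative_at_withinI scaleR_diff_right)
      have "norm (?D b - f' x b) \<le> e"
        using d[of x "x + s *\<^sub>R b"] mem[of 0] mem[of s] s h \<open>b \<in> Basis\<close>
        by (auto simp: dist_norm)
      then show "onorm (\<lambda>t. t *\<^sub>R (?D b - f' x b)) \<le> e"
        by (intro onorm_le) (auto simp: mult.commute[of e] intro!: mult_left_mono)
    qed (use h in auto)
    then have "norm (f (x + h *\<^sub>R b) - f x - h *\<^sub>R f' x b) \<le> e * h"
      using h by (simp add: g_def algebra_simps)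
    moreover have "f (x + h *\<^sub>R b) - f x - h *\<^sub>R f' x b
        = h *\<^sub>R ((1 / h) *\<^sub>R (f (x + h *\<^sub>R b) - f x) - f' x b)"
      using h by (simp add: scaleR_diff_right)
    ultimately have "norm ((1 / h) *\<^sub>R (f (x + h *\<^sub>R b) - f x) - f' x b) \<le> e"
      using h by (simp add: mult.commute)
    then show "dist ((1 / h) *\<^sub>R (f (x + h *\<^sub>R b) - f x)) (f' x b) < e'"
      using e by (simp add: dist_norm)
  qed
qed

section \<open>Traces of compound operators\<close>

lemma op_trace_add: "op_trace (\<lambda>k. A k + B k) = op_trace A + op_trace B"
  by (simp add: op_trace_def inner_add_left sum.distrib)

lemma op_trace_diff: "op_trace (\<lambda>k. A k - B k) = op_trace A - op_trace B"
  by (simp add: op_trace_def inner_diff_left sum_subtractf)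

lemma op_trace_scaleR: "op_trace (\<lambda>k. c *\<^sub>R A k) = c * op_trace A"
  by (simp add: op_trace_def sum_distrib_left)

lemma op_trace_sum: "op_trace (\<lambda>k. \<Sum>i\<in>I. A i k) = (\<Sum>i\<in>I. op_trace (A i))"
  unfolding op_trace_def inner_sum_left by (rule sum.swap)

lemma op_trace_rank_one: "op_trace (\<lambda>k. (c * (a \<bullet> k)) *\<^sub>R a) = c * (norm a)\<^sup>2"
proof -
  have "op_trace (\<lambda>k. (c * (a \<bullet> k)) *\<^sub>R a) = c * (\<Sum>b\<in>Basis. (a \<bullet> b) * (a \<bullet> b))"
    by (simp add: op_trace_def sum_distrib_left algebra_simps)
  then show ?thesis
    by (simp add: euclidean_inner[of a a] power2_norm_eq_inner)
qed

lemma op_trace_id: "op_trace (\<lambda>k::'a::euclidean_space. k) = real DIM('a)"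
  by (simp add: op_trace_def)

section \<open>The P-function and its viscosity inequality\<close>

text \<open>Weinberger's P-function for the normalisation \<Delta>u = -n; for the Serrin solution on
  the unit ball it is identically 1.\<close>

definition P_fun :: "('a::euclidean_space \<Rightarrow> real) \<Rightarrow> ('a \<Rightarrow> 'a) \<Rightarrow> 'a \<Rightarrow> real" where
  "P_fun u G x = (norm (G x))\<^sup>2 + 2 * u x"

lemma norm_square_euclidean: "(norm a)\<^sup>2 = (\<Sum>b\<in>Basis. (a \<bullet> b)\<^sup>2)"
  for a :: "'a::euclidean_space"
  unfolding power2_norm_eq_inner by (subst euclidean_inner) (simp add: power2_eq_square)

lemma serrin_solution_hess:
  assumes "serrin_solution \<Omega> u G"
  shows "hess_on u G (\<lambda>x. frechet_derivative G (at x)) \<Omega>"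
  using assms unfolding serrin_solution_def hess_on_def
  by (auto simp: frechet_derivative_works[symmetric])

lemma serrin_solution_trace:
  fixes u :: "'a::euclidean_space \<Rightarrow> real"
  assumes "serrin_solution \<Omega> u G" "x \<in> \<Omega>"
  shows "op_trace (frechet_derivative G (at x)) = - real DIM('a)"
  using assms unfolding serrin_solution_def op_trace_def by blast

lemma hess_on_norm_square:
  fixes a :: "'a::euclidean_space"
  shows "hess_on (\<lambda>x. (norm (x - a))\<^sup>2) (\<lambda>x. 2 *\<^sub>R (x - a)) (\<lambda>x k. 2 *\<^sub>R k) S"
  unfolding hess_on_def power2_norm_eq_inner
  by (auto intro!: derivative_eq_intros simp: inner_commute algebra_simps)

lemma uniform_limit_sum:
  fixes f :: "'i \<Rightarrow> 'b \<Rightarrow> 'c \<Rightarrow> 'd::real_normed_vector"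
  assumes "finite I" "\<And>i. i \<in> I \<Longrightarrow> uniform_limit S (f i) (l i) F"
  shows "uniform_limit S (\<lambda>h x. \<Sum>i\<in>I. f i h x) (\<lambda>x. \<Sum>i\<in>I. l i x) F"
  using assms
proof (induction I rule: finite_induct)
  case empty
  show ?case by (simp add: uniform_limit_iff)
next
  case (insert i I)
  then show ?case by (simp add: uniform_limit_add)
qed

text \<open>\<open>P\<close> is approximated by \<open>P\<^sub>h(x) = (\<Sum>b. ((u (x + h b) - u x) / h)\<^sup>2) + 2 u x\<close>, which is of class
  \<open>C\<^sup>2\<close>. Difference quotients of \<open>u\<close> are harmonic because \<open>\<Delta>u\<close> is constant, so that
  \<open>\<Delta>P\<^sub>h = 2 (\<Sum>b. |(\<nabla>u (x + h b) - \<nabla>u x) / h|\<^sup>2) - 2 n\<close> involves no third derivatives.\<close>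

lemma P_fun_touching:
  fixes u :: "'a::euclidean_space \<Rightarrow> real"
  assumes sol: "serrin_solution \<Omega> u G" and sub: "ball x0 R \<subseteq> \<Omega>" and "R > 0"
    and hess: "hess_on \<phi> \<Phi> L (ball x0 R)"
    and contL: "continuous_on (ball x0 R) (\<lambda>x. op_trace (L x))"
    and max: "\<And>y. y \<in> ball x0 R \<Longrightarrow> P_fun u G y + \<phi> y \<le> P_fun u G x0 + \<phi> x0"
  shows "op_trace (L x0) + 2 * (\<Sum>b\<in>Basis. (norm (frechet_derivative G (at x0) b + b))\<^sup>2) \<le> 0"
proof (rule ccontr)
  let ?n = "real DIM('a)"
  let ?D = "\<lambda>x. frechet_derivative G (at x)"
  have x0: "x0 \<in> \<Omega>" using sub \<open>R > 0\<close> by auto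
  have hu: "hess_on u G ?D \<Omega>" by (rule serrin_solution_hess[OF sol])
  have contD: "continuous_on \<Omega> (\<lambda>x. ?D x b)" if "b \<in> Basis" for b
    using sol that by (simp add: serrin_solution_def)
  have contG: "continuous_on \<Omega> G"
    using hu unfolding hess_on_def by (meson continuous_at_imp_continuous_on has_derivative_continuous)
  \<comment> \<open>Since the Hessian has trace -n, |D^2u + I|^2 equals |D^2u|^2 - n, and |D^2u|^2
    is what the difference quotients of \<open>G\<close> approximate.\<close>
  have "(\<Sum>b\<in>Basis. (norm (?D x0 b + b))\<^sup>2)
      = (\<Sum>b\<in>Basis. (norm (?D x0 b))\<^sup>2 + 2 * (?D x0 b \<bullet> b) + 1)"
    by (intro sum.cong) (auto simp: power2_norm_eq_inner algebra_simps inner_commute)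
  also have "\<dots> = (\<Sum>b\<in>Basis. (norm (?D x0 b))\<^sup>2) + 2 * op_trace (?D x0) + ?n"
    by (simp add: sum.distrib op_trace_def sum_distrib_left)
  finally have sq: "(\<Sum>b\<in>Basis. (norm (?D x0 b + b))\<^sup>2) = (\<Sum>b\<in>Basis. (norm (?D x0 b))\<^sup>2) - ?n"
    using serrin_solution_trace[OF sol x0] by simp
  define \<kappa> where "\<kappa> = op_trace (L x0) + 2 * (\<Sum>b\<in>Basis. (norm (?D x0 b))\<^sup>2) - 2 * ?n"
  assume "\<not> ?thesis"
  then have "\<kappa> > 0" using sq by (simp add: \<kappa>_def)
  \<comment> \<open>The penalty -\<epsilon> |x - x0|^2 has Laplacian -2 n \<epsilon>, so this choice
    spends exactly half of the excess \<kappa>.\<close>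
  define \<epsilon> where "\<epsilon> = \<kappa> / (4 * ?n)"
  have "\<epsilon> > 0" using \<open>\<kappa> > 0\<close> by (simp add: \<epsilon>_def)
  have n\<epsilon>: "2 * ?n * \<epsilon> = \<kappa> / 2" by (simp add: \<epsilon>_def)
  \<comment> \<open>\<open>Q\<close> is the formal Laplacian of P + \<phi>, with \<open>Q x0\<close>
    = \<kappa>. Near \<open>x0\<close> at least 3\<kappa>/4 survives; the penalty costs \<kappa>/2
    and the approximation 2 \<kappa>/16, which leaves more than \<kappa>/8.\<close>
  define Q where "Q = (\<lambda>x. op_trace (L x) + 2 * (\<Sum>b\<in>Basis. (norm (?D x b))\<^sup>2) - 2 * ?n)"
  have "continuous_on (ball x0 R) Q"
    unfolding Q_def by (intro continuous_intros contL continuous_on_subset[OF contD sub])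
  then have "(Q \<longlongrightarrow> Q x0) (nhds x0)"
    using \<open>R > 0\<close>
    by (simp add: continuous_on_eq_continuous_at isCont_def tendsto_at_iff_tendsto_nhds)
  moreover have "Q x0 > 3 * \<kappa> / 4" using \<open>\<kappa> > 0\<close> by (simp add: Q_def \<kappa>_def)
  ultimately have "\<forall>\<^sub>F x in nhds x0. Q x > 3 * \<kappa> / 4"
    by (rule order_tendstoD(1))
  then obtain d where "d > 0" and d: "\<And>x. dist x x0 < d \<Longrightarrow> Q x > 3 * \<kappa> / 4"
    by (auto simp: eventually_nhds_metric)
  define \<delta> where "\<delta> = min d R / 3"
  have \<delta>: "0 < \<delta>" "\<delta> < d" "2 * \<delta> < R" using \<open>d > 0\<close> \<open>R > 0\<close> by (auto simp: \<delta>_def)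
  have subR: "cball x0 (2 * \<delta>) \<subseteq> ball x0 R" using \<delta> by auto
  have sub1: "cball x0 \<delta> \<subseteq> ball x0 R" using \<delta> by auto
  have sub\<Omega>: "cball x0 (2 * \<delta>) \<subseteq> \<Omega>" using sub subR by blast
  have sub1\<Omega>: "cball x0 \<delta> \<subseteq> \<Omega>" using sub sub1 by blast
  define du where "du = (\<lambda>h b x. (1 / h) *\<^sub>R (u (x + h *\<^sub>R b) - u x))"
  define dG where "dG = (\<lambda>h b x. (1 / h) *\<^sub>R (G (x + h *\<^sub>R b) - G x))"
  have lim_u: "uniform_limit (cball x0 \<delta>) (\<lambda>h. du h b) (\<lambda>x. G x \<bullet> b) (at_right 0)"
    if "b \<in> Basis" for b
    unfolding du_def
  proof (rule difference_quotient_uniform)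
    show "(u has_derivative (\<lambda>k. G x \<bullet> k)) (at x)" if "x \<in> cball x0 (2 * \<delta>)" for x
      using hu sub\<Omega> that by (auto simp: hess_on_def)
    show "continuous_on (cball x0 (2 * \<delta>)) (\<lambda>x. G x \<bullet> b)"
      by (intro continuous_intros continuous_on_subset[OF contG sub\<Omega>])
  qed (use that \<delta> in auto)
  have lim_G: "uniform_limit (cball x0 \<delta>) (\<lambda>h. dG h b) (\<lambda>x. ?D x b) (at_right 0)"
    if "b \<in> Basis" for b
    unfolding dG_def
  proof (rule difference_quotient_uniform)
    show "(G has_derivative ?D x) (at x)" if "x \<in> cball x0 (2 * \<delta>)" for x
      using hu sub\<Omega> that by (auto simp: hess_on_def)
    show "continuous_on (cball x0 (2 * \<delta>)) (\<lambda>x. ?D x b)"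
      by (rule continuous_on_subset[OF contD[OF that] sub\<Omega>])
  qed (use that \<delta> in auto)
  have bdd: "bounded ((\<lambda>x. G x \<bullet> b) ` cball x0 \<delta>)" for b
    by (intro compact_imp_bounded compact_continuous_image continuous_intros
        continuous_on_subset[OF contG sub1\<Omega>] compact_cball)
  have bddD: "bounded ((\<lambda>x. ?D x b) ` cball x0 \<delta>)" if "b \<in> Basis" for b
    by (intro compact_imp_bounded compact_continuous_image
        continuous_on_subset[OF contD[OF that] sub1\<Omega>] compact_cball)
  define Ph where "Ph = (\<lambda>h x. (\<Sum>b\<in>Basis. (du h b x)\<^sup>2) + 2 * u x)"
  have "uniform_limit (cball x0 \<delta>) (\<lambda>h x. \<Sum>b\<in>Basis. du h b x * du h b x)
      (\<lambda>x. \<Sum>b\<in>Basis. (G x \<bullet> b) * (G x \<bullet> b)) (at_right 0)"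
    by (intro uniform_limit_sum finite_Basis bounded_bilinear.bounded_uniform_limit[OF bounded_bilinear_mult]
        lim_u bdd)
  then have limP: "uniform_limit (cball x0 \<delta>) Ph (P_fun u G) (at_right 0)"
    unfolding uniform_limit_iff Ph_def P_fun_def norm_square_euclidean
    by (simp add: power2_eq_square dist_real_def)
  have limD: "uniform_limit (cball x0 \<delta>) (\<lambda>h x. \<Sum>b\<in>Basis. dG h b x \<bullet> dG h b x)
      (\<lambda>x. \<Sum>b\<in>Basis. ?D x b \<bullet> ?D x b) (at_right 0)"
    by (intro uniform_limit_sum finite_Basis bounded_bilinear.bounded_uniform_limit[OF bounded_bilinear_inner]
        lim_G bddD)
  \<comment> \<open>The tolerance \<epsilon> \<delta>^2 / 3 is a third of the penalty on the sphere
    of radius \<delta>; \<kappa>/16 is the share reserved for the second-order terms.\<close>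
  have "\<forall>\<^sub>F h in at_right 0. 0 < h \<and> h < \<delta> \<and>
      (\<forall>x\<in>cball x0 \<delta>. dist (Ph h x) (P_fun u G x) < \<epsilon> * \<delta>\<^sup>2 / 3) \<and>
      (\<forall>x\<in>cball x0 \<delta>. dist (\<Sum>b\<in>Basis. dG h b x \<bullet> dG h b x) (\<Sum>b\<in>Basis. ?D x b \<bullet> ?D x b) < \<kappa> / 16)"
    using \<delta> \<open>\<epsilon> > 0\<close> \<open>\<kappa> > 0\<close>
    by (intro eventually_conj uniform_limitD[OF limP] uniform_limitD[OF limD]
        eventually_at_right_less eventually_at_right_field[THEN iffD2]) auto
  then obtain h where h: "0 < h" "h < \<delta>"
    and hP: "\<And>x. x \<in> cball x0 \<delta> \<Longrightarrow> \<bar>Ph h x - P_fun u G x\<bar> < \<epsilon> * \<delta>\<^sup>2 / 3"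
    and hD: "\<And>x. x \<in> cball x0 \<delta> \<Longrightarrow>
      \<bar>(\<Sum>b\<in>Basis. (norm (dG h b x))\<^sup>2) - (\<Sum>b\<in>Basis. (norm (?D x b))\<^sup>2)\<bar> < \<kappa> / 16"
    using eventually_happens'[OF trivial_limit_at_right_real]
    unfolding dist_real_def power2_norm_eq_inner by blast
  have shift: "x + h *\<^sub>R b \<in> \<Omega>" if "x \<in> cball x0 \<delta>" "b \<in> Basis" for x b
  proof (rule subsetD[OF sub\<Omega>])
    have "dist x0 (x + h *\<^sub>R b) \<le> dist x0 x + h"
      using dist_triangle[of x0 "x + h *\<^sub>R b" x] that h by (simp add: dist_norm)
    then show "x + h *\<^sub>R b \<in> cball x0 (2 * \<delta>)" using that h by simp
  qed
  define \<psi> where "\<psi> = (\<lambda>x. \<phi> x + (- \<epsilon>) * (norm (x - x0))\<^sup>2)"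
  define f where "f = (\<lambda>x. Ph h x + \<psi> x)"
  define A where "A = (\<lambda>b x k. (2 * (dG h b x \<bullet> k)) *\<^sub>R dG h b x
      + (2 * du h b x) *\<^sub>R ((1 / h) *\<^sub>R (?D (x + h *\<^sub>R b) k - ?D x k)))"
  define H where "H = (\<lambda>x k. ((\<Sum>b\<in>Basis. A b x k) + 2 *\<^sub>R ?D x k) + (L x k + (- \<epsilon>) *\<^sub>R (2 *\<^sub>R k)))"
  have hdu: "hess_on (du h b) (dG h b) (\<lambda>x k. (1 / h) *\<^sub>R (?D (x + h *\<^sub>R b) k - ?D x k)) (ball x0 \<delta>)"
    if "b \<in> Basis" for b
    using hess_on_cmult[OF hess_on_add[OF hess_on_shift[OF hu, of "ball x0 \<delta>" "h *\<^sub>R b"]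
        hess_on_cmult[OF hess_on_subset[OF hu, of "ball x0 \<delta>"], of "-1"]], of "1 / h"]
      shift that sub1\<Omega> ball_subset_cball[of x0 \<delta>]
    by (simp add: du_def dG_def subset_iff)
  have hf: "\<exists>F. hess_on f F H (ball x0 \<delta>)"
  proof -
    have bs: "ball x0 \<delta> \<subseteq> \<Omega>" "ball x0 \<delta> \<subseteq> ball x0 R"
      using sub1 sub1\<Omega> ball_subset_cball by blast+
    have "hess_on (\<lambda>x. \<Sum>b\<in>Basis. (du h b x)\<^sup>2) (\<lambda>x. \<Sum>b\<in>Basis. (2 * du h b x) *\<^sub>R dG h b x)
        (\<lambda>x k. \<Sum>b\<in>Basis. A b x k) (ball x0 \<delta>)"
      unfolding A_def by (intro hess_on_sum finite_Basis hess_on_square hdu)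
    from hess_on_add[OF hess_on_add[OF this hess_on_cmult[OF hess_on_subset[OF hu bs(1)], of 2]]
        hess_on_add[OF hess_on_subset[OF hess bs(2)] hess_on_cmult[OF hess_on_norm_square]]]
    show ?thesis unfolding f_def Ph_def \<psi>_def H_def by blast
  qed
  have cf: "continuous_on (cball x0 \<delta>) f"
  proof -
    have cu: "continuous_on \<Omega> u" by (rule hess_on_continuous[OF hu])
    have "continuous_on (cball x0 \<delta>) (\<lambda>x. u (x + h *\<^sub>R b))" if "b \<in> Basis" for b
      by (rule continuous_on_compose2[OF cu]) (use shift that in \<open>auto intro!: continuous_intros\<close>)
    then show ?thesis
      unfolding f_def Ph_def \<psi>_def du_def
      by (intro continuous_intros continuous_on_subset[OF cu sub1\<Omega>]
          continuous_on_subset[OF hess_on_continuous[OF hess] sub1]) auto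
  qed
  obtain y where y: "y \<in> cball x0 \<delta>" and ymax: "\<And>x. x \<in> cball x0 \<delta> \<Longrightarrow> f x \<le> f y"
    using continuous_attains_sup[OF compact_cball _ cf] \<delta> by fastforce
  \<comment> \<open>On the sphere the penalty \<epsilon> \<delta>^2 exceeds the two approximation
    errors, one at \<open>y\<close> and one at \<open>x0\<close>, so \<open>f\<close> is larger at
    the centre and its maximum is interior.\<close>
  have "dist x0 y < \<delta>"
  proof (rule ccontr)
    assume "\<not> dist x0 y < \<delta>"
    then have "norm (y - x0) = \<delta>" using y by (simp add: dist_norm norm_minus_commute)
    then have "f y \<le> P_fun u G y + \<epsilon> * \<delta>\<^sup>2 / 3 + \<phi> y - \<epsilon> * \<delta>\<^sup>2"
      using hP[OF y] unfolding f_def \<psi>_def abs_less_iff by simp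
    also have "\<dots> \<le> P_fun u G x0 + \<phi> x0 - 2 * (\<epsilon> * \<delta>\<^sup>2 / 3)"
      using max[of y] y sub1 by auto
    also have "\<dots> < f x0"
      using hP[of x0] \<delta> mult_pos_pos[OF \<open>\<epsilon> > 0\<close>, of "\<delta>\<^sup>2"] unfolding f_def \<psi>_def abs_less_iff
      by simp
    finally show False using ymax[of x0] \<delta> by simp
  qed
  then have "op_trace (H y) \<le> 0"
    using hf op_trace_hess_at_max[of f _ H "ball x0 \<delta>" y] ymax by auto
  moreover have "op_trace (H y) = 2 * (\<Sum>b\<in>Basis. (norm (dG h b y))\<^sup>2) - 2 * ?n
      + op_trace (L y) - 2 * ?n * \<epsilon>"
  proof -
    \<comment> \<open>The part of \<open>A b y\<close> that contains \<open>du\<close> has trace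
      zero, because the Hessian of \<open>u\<close> has the same trace at \<open>y\<close> and at
      the shifted point.\<close>
    have "op_trace (A b y) = 2 * (norm (dG h b y))\<^sup>2" if "b \<in> Basis" for b
      using serrin_solution_trace[OF sol] shift[OF y that] sub1\<Omega> y
      by (auto simp: A_def op_trace_add op_trace_scaleR op_trace_diff op_trace_rank_one)
    then have "(\<Sum>b\<in>Basis. op_trace (A b y)) = 2 * (\<Sum>b\<in>Basis. (norm (dG h b y))\<^sup>2)"
      by (simp add: sum_distrib_left)
    moreover have "op_trace (H y) = ((\<Sum>b\<in>Basis. op_trace (A b y)) + 2 * op_trace (?D y))
        + (op_trace (L y) + (- \<epsilon>) * (2 * ?n))"
      unfolding H_def by (simp only: op_trace_add op_trace_sum op_trace_scaleR op_trace_id)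
    moreover have "op_trace (?D y) = - ?n"
      using serrin_solution_trace[OF sol] sub1\<Omega> y by blast
    ultimately show ?thesis by simp
  qed
  moreover have "Q y > 3 * \<kappa> / 4"
    using d[of y] \<delta> y by (simp add: dist_commute)
  ultimately show False
    using hD[OF y] n\<epsilon> \<open>\<kappa> > 0\<close> by (simp add: Q_def abs_less_iff)
qed

section \<open>Maximum principles for the P-function\<close>

lemma P_fun_continuous:
  assumes "serrin_solution \<Omega> u G"
  shows "continuous_on (closure \<Omega>) (P_fun u G)"
  using assms unfolding P_fun_def serrin_solution_def by (auto intro!: continuous_intros)

text \<open>At an interior maximum of P + \<phi> the touching inequality would make the trace of
  \<open>L\<close> nonpositive. With a strictly subharmonic \<phi> the maximum over the closure
  therefore lies on the frontier.\<close>

lemma P_fun_comparison: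
  fixes u :: "'a::euclidean_space \<Rightarrow> real"
  assumes sol: "serrin_solution \<Omega> u G" and U: "open U" "bounded U" "U \<subseteq> \<Omega>"
    and hess: "hess_on \<phi> \<Phi> L U" and contL: "continuous_on U (\<lambda>x. op_trace (L x))"
    and pos: "\<And>x. x \<in> U \<Longrightarrow> op_trace (L x) > 0" and cont\<phi>: "continuous_on (closure U) \<phi>"
    and front: "\<And>x. x \<in> frontier U \<Longrightarrow> P_fun u G x + \<phi> x \<le> M" and "x \<in> U"
  shows "P_fun u G x + \<phi> x \<le> M"
proof -
  have "continuous_on (closure U) (\<lambda>x. P_fun u G x + \<phi> x)"
    by (intro continuous_intros cont\<phi> continuous_on_subset[OF P_fun_continuous[OF sol]]
        closure_mono U)
  moreover have "compact (closure U)" "closure U \<noteq> {}"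
    using U \<open>x \<in> U\<close> by (auto simp: compact_closure)
  ultimately obtain y where y: "y \<in> closure U"
    and max: "\<And>z. z \<in> closure U \<Longrightarrow> P_fun u G z + \<phi> z \<le> P_fun u G y + \<phi> y"
    using continuous_attains_sup[of "closure U"] by blast
  have "y \<notin> U"
  proof
    assume "y \<in> U"
    then obtain R where R: "R > 0" "ball y R \<subseteq> U"
      using \<open>open U\<close> open_contains_ball by blast
    have "op_trace (L y) + 2 * (\<Sum>b\<in>Basis. (norm (frechet_derivative G (at y) b + b))\<^sup>2) \<le> 0"
    proof (rule P_fun_touching[OF sol])
      show "ball y R \<subseteq> \<Omega>" using R U by blast
      show "hess_on \<phi> \<Phi> L (ball y R)" "continuous_on (ball y R) (\<lambda>x. op_trace (L x))"
        using R hess contL by (auto intro: hess_on_subset continuous_on_subset)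
      show "P_fun u G z + \<phi> z \<le> P_fun u G y + \<phi> y" if "z \<in> ball y R" for z
        using max[of z] that R closure_subset[of U] by blast
    qed (use R in simp)
    moreover have "(\<Sum>b\<in>Basis. (norm (frechet_derivative G (at y) b + b))\<^sup>2) \<ge> 0"
      by (simp add: sum_nonneg)
    ultimately show False using pos[OF \<open>y \<in> U\<close>] by linarith
  qed
  then have "y \<in> frontier U" using y \<open>open U\<close> by (simp add: frontier_def interior_open)
  then show ?thesis using front[of y] max[of x] \<open>x \<in> U\<close> closure_subset by fastforce
qed

text \<open>Adding a small multiple of |x|^2, which is strictly subharmonic, reduces this to the
  comparison lemma; the multiple then tends to zero.\<close>

lemma P_fun_weak_maximum_principle:
  fixes u :: "'a::euclidean_space \<Rightarrow> real"
  assumes sol: "serrin_solution \<Omega> u G" and U: "open U" "bounded U" "U \<subseteq> \<Omega>"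
    and front: "\<And>x. x \<in> frontier U \<Longrightarrow> P_fun u G x \<le> M" and "x \<in> U"
  shows "P_fun u G x \<le> M"
proof (rule field_le_epsilon)
  fix e :: real assume "e > 0"
  obtain B where "B > 0" and B: "\<And>y. y \<in> closure U \<Longrightarrow> norm y \<le> B"
    using bounded_closure[OF \<open>bounded U\<close>] bounded_pos by blast
  \<comment> \<open>With this coefficient the perturbation is at most \<open>e\<close> on the
    closure of \<open>U\<close>.\<close>
  define \<epsilon> where "\<epsilon> = e / B\<^sup>2"
  have "\<epsilon> > 0" using \<open>e > 0\<close> \<open>B > 0\<close> by (simp add: \<epsilon>_def)
  have "\<epsilon> * (norm y)\<^sup>2 \<le> e" if "y \<in> closure U" for y
  proof -
    have "\<epsilon> * (norm y)\<^sup>2 \<le> \<epsilon> * B\<^sup>2"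
      using B[OF that] \<open>\<epsilon> > 0\<close> by (intro mult_left_mono power_mono) auto
    then show ?thesis using \<open>B > 0\<close> by (simp add: \<epsilon>_def)
  qed
  then have fr: "P_fun u G y + \<epsilon> * (norm (y - 0))\<^sup>2 \<le> M + e" if "y \<in> frontier U" for y
    using front[OF that] that by (simp add: frontier_def add_mono)
  have "op_trace (\<lambda>k::'a. \<epsilon> *\<^sub>R (2 *\<^sub>R k)) = \<epsilon> * (2 * real DIM('a))"
    by (simp only: op_trace_scaleR op_trace_id)
  then have tr: "op_trace (\<lambda>k::'a. \<epsilon> *\<^sub>R (2 *\<^sub>R k)) > 0"
    using \<open>\<epsilon> > 0\<close> by simp
  have "P_fun u G x + \<epsilon> * (norm (x - 0))\<^sup>2 \<le> M + e"
  proof (rule P_fun_comparison[OF sol U hess_on_cmult[OF hess_on_norm_square] continuous_on_const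
        tr _ fr \<open>x \<in> U\<close>])
    show "continuous_on (closure U) (\<lambda>x. \<epsilon> * (norm (x - 0))\<^sup>2)"
      by (intro continuous_intros)
  qed
  moreover have "\<epsilon> * (norm (x - 0))\<^sup>2 \<ge> 0" using \<open>\<epsilon> > 0\<close> by simp
  ultimately show "P_fun u G x \<le> M + e" by linarith
qed

section \<open>The Hopf lemma for the P-function\<close>

text \<open>This is the Hopf barrier. Its Hessian is kept as a rank-one map plus a multiple of the
  identity, so that \<open>op_trace_rank_one\<close> and \<open>op_trace_id\<close> give its
  trace.\<close>

lemma hess_on_gaussian:
  fixes a :: "'a::euclidean_space"
  shows "hess_on (\<lambda>x. exp (- \<alpha> * (norm (x - a))\<^sup>2))
     (\<lambda>x. (- 2 * \<alpha> * exp (- \<alpha> * (norm (x - a))\<^sup>2)) *\<^sub>R (x - a))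
     (\<lambda>x k. (4 * \<alpha>\<^sup>2 * exp (- \<alpha> * (norm (x - a))\<^sup>2) * ((x - a) \<bullet> k)) *\<^sub>R (x - a)
        + (- 2 * \<alpha> * exp (- \<alpha> * (norm (x - a))\<^sup>2)) *\<^sub>R k) S"
proof -
  have d: "((\<lambda>x. exp (- \<alpha> * (norm (x - a))\<^sup>2)) has_derivative
      (\<lambda>k. (- 2 * \<alpha> * exp (- \<alpha> * (norm (x - a))\<^sup>2)) * ((x - a) \<bullet> k))) (at x)" for x
    unfolding power2_norm_eq_inner
    by (auto intro!: derivative_eq_intros simp: fun_eq_iff inner_commute algebra_simps)
  show ?thesis
    unfolding hess_on_def
  proof (intro ballI conjI)
    fix x
    show "((\<lambda>x. exp (- \<alpha> * (norm (x - a))\<^sup>2)) has_derivative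
       (\<lambda>h. (- 2 * \<alpha> * exp (- \<alpha> * (norm (x - a))\<^sup>2)) *\<^sub>R (x - a) \<bullet> h)) (at x)"
      using d by simp
    show "((\<lambda>x. (- 2 * \<alpha> * exp (- \<alpha> * (norm (x - a))\<^sup>2)) *\<^sub>R (x - a)) has_derivative
       (\<lambda>k. (4 * \<alpha>\<^sup>2 * exp (- \<alpha> * (norm (x - a))\<^sup>2) * ((x - a) \<bullet> k)) *\<^sub>R (x - a)
        + (- 2 * \<alpha> * exp (- \<alpha> * (norm (x - a))\<^sup>2)) *\<^sub>R k)) (at x)"
      by (rule derivative_eq_intros refl d)+
        (simp add: fun_eq_iff power2_eq_square mult_ac)
  qed
qed

text \<open>On the annulus between radii r/2 and r, comparison bounds P + \<epsilon> g by its value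
  M + \<epsilon> C at \<open>q\<close>. If the derivative of P vanished at \<open>q\<close>, then P
  + \<epsilon> g would strictly increase from \<open>q\<close> towards \<open>a\<close>, since the
  Gaussian does, and would break this bound inside the annulus.\<close>

lemma P_fun_hopf:
  fixes u :: "'a::euclidean_space \<Rightarrow> real"
  assumes sol: "serrin_solution \<Omega> u G" and sub: "cball a r \<subseteq> \<Omega>" and "r > 0"
    and less: "\<And>x. x \<in> ball a r \<Longrightarrow> P_fun u G x < M"
    and q: "dist a q = r" "P_fun u G q = M"
  shows "\<not> (P_fun u G has_derivative (\<lambda>h. 0)) (at q)"
proof
  assume der: "(P_fun u G has_derivative (\<lambda>h. 0)) (at q)"
  let ?n = "real DIM('a)"
  have "?n > 0" by simp
  have contP: "continuous_on (cball a r) (P_fun u G)"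
    using continuous_on_subset[OF P_fun_continuous[OF sol]] sub closure_subset by blast
  have le: "P_fun u G x \<le> M" if "x \<in> cball a r" for x
    using continuous_le_on_closure[of "ball a r" "P_fun u G" x M] contP that less \<open>r > 0\<close>
    by (auto intro: less_imp_le)
  \<comment> \<open>The Laplacian of the Gaussian is 2 \<alpha> g (2 \<alpha> |x - a|^2 - n). Beyond
    radius r/2 this choice makes 2 \<alpha> |x - a|^2 larger than 2 n, so the Laplacian is positive
    there.\<close>
  define \<alpha> where "\<alpha> = 4 * ?n / r\<^sup>2"
  have "\<alpha> > 0" using \<open>r > 0\<close> by (simp add: \<alpha>_def)
  define g where "g = (\<lambda>x. exp (- \<alpha> * (norm (x - a))\<^sup>2))"
  define U where "U = ball a r - cball a (r / 2)"
  have "closed (cball a r - ball a (r / 2))"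
    by (rule closed_Diff) auto
  then have clU: "closure U \<subseteq> cball a r - ball a (r / 2)"
    by (rule closure_minimal[rotated]) (auto simp: U_def)
  have frU: "dist a x = r \<or> dist a x = r / 2" if "x \<in> frontier U" for x
  proof -
    have "open U" by (simp add: U_def open_Diff)
    then have "x \<in> closure U" "x \<notin> U" using that by (auto simp: frontier_def interior_open)
    then show ?thesis using clU by (auto simp: U_def)
  qed
  \<comment> \<open>The inner sphere is compact and lies in the open ball, so P stays below M by a
    fixed gap on it.\<close>
  obtain m where m: "m < M" "\<And>x. dist a x = r / 2 \<Longrightarrow> P_fun u G x \<le> m"
  proof -
    have "sphere a (r / 2) \<subseteq> cball a r" using \<open>r > 0\<close> by auto
    then have c: "continuous_on (sphere a (r / 2)) (P_fun u G)"
      using continuous_on_subset[OF contP] by blast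
    have "sphere a (r / 2) \<noteq> {}"
      using \<open>r > 0\<close> by (metis half_gt_zero less_imp_le not_less sphere_eq_empty)
    then obtain y where y: "y \<in> sphere a (r / 2)" "\<And>x. x \<in> sphere a (r / 2) \<Longrightarrow> P_fun u G x \<le> P_fun u G y"
      using continuous_attains_sup[OF compact_sphere _ c] by blast
    show thesis
      by (rule that[of "P_fun u G y"]) (use y \<open>r > 0\<close> less[of y] in auto)
  qed
  \<comment> \<open>As g is at most 1, adding \<epsilon> g to P on the inner sphere just fills the
    gap.\<close>
  define \<epsilon> where "\<epsilon> = M - m"
  have "\<epsilon> > 0" using m by (simp add: \<epsilon>_def)
  \<comment> \<open>This is the value of g on the outer sphere, in particular at
    \<open>q\<close>.\<close>
  define C where "C = exp (- \<alpha> * r\<^sup>2)"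
  have "C > 0" by (simp add: C_def)
  have comp: "P_fun u G x + \<epsilon> * g x \<le> M + \<epsilon> * C" if "x \<in> U" for x
    unfolding g_def
  proof (rule P_fun_comparison[OF sol _ _ _ hess_on_cmult[OF hess_on_gaussian] _ _ _ _ \<open>x \<in> U\<close>])
    show "open U" "bounded U" "U \<subseteq> \<Omega>"
      using sub by (auto simp: U_def open_Diff intro: bounded_subset)
    show "continuous_on (closure U) (\<lambda>x. \<epsilon> * exp (- \<alpha> * (norm (x - a))\<^sup>2))"
      by (intro continuous_intros)
    have tr: "op_trace (\<lambda>h. \<epsilon> *\<^sub>R ((4 * \<alpha>\<^sup>2 * exp (- \<alpha> * (norm (y - a))\<^sup>2) * ((y - a) \<bullet> h)) *\<^sub>R (y - a)
        + (- 2 * \<alpha> * exp (- \<alpha> * (norm (y - a))\<^sup>2)) *\<^sub>R h))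
      = \<epsilon> * (2 * \<alpha> * exp (- \<alpha> * (norm (y - a))\<^sup>2) * (2 * \<alpha> * (norm (y - a))\<^sup>2 - ?n))" for y
      by (simp only: op_trace_scaleR op_trace_add op_trace_rank_one op_trace_id)
        (simp add: algebra_simps power2_eq_square)
    show "continuous_on U (\<lambda>x. op_trace (\<lambda>h. \<epsilon> *\<^sub>R ((4 * \<alpha>\<^sup>2 * exp (- \<alpha> * (norm (x - a))\<^sup>2)
        * ((x - a) \<bullet> h)) *\<^sub>R (x - a) + (- 2 * \<alpha> * exp (- \<alpha> * (norm (x - a))\<^sup>2)) *\<^sub>R h)))"
      unfolding tr by (intro continuous_intros)
    show "0 < op_trace (\<lambda>h. \<epsilon> *\<^sub>R ((4 * \<alpha>\<^sup>2 * exp (- \<alpha> * (norm (y - a))\<^sup>2)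
        * ((y - a) \<bullet> h)) *\<^sub>R (y - a) + (- 2 * \<alpha> * exp (- \<alpha> * (norm (y - a))\<^sup>2)) *\<^sub>R h))"
      if "y \<in> U" for y
    proof -
      have "norm (y - a) > r / 2"
        using that by (simp add: U_def dist_norm norm_minus_commute)
      then have "(norm (y - a))\<^sup>2 > (r / 2)\<^sup>2"
        using \<open>r > 0\<close> by (intro power_strict_mono) auto
      then have "2 * \<alpha> * (norm (y - a))\<^sup>2 > 2 * \<alpha> * (r / 2)\<^sup>2"
        using \<open>\<alpha> > 0\<close> by simp
      also have "2 * \<alpha> * (r / 2)\<^sup>2 = 2 * ?n"
        using \<open>r > 0\<close> by (simp add: \<alpha>_def field_simps power2_eq_square)
      finally have "2 * \<alpha> * (norm (y - a))\<^sup>2 - ?n > 0" using \<open>?n > 0\<close> by linarith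
      then show ?thesis
        unfolding tr using \<open>\<epsilon> > 0\<close> \<open>\<alpha> > 0\<close> by simp
    qed
    fix y assume "y \<in> frontier U"
    then consider "dist a y = r" | "dist a y = r / 2" using frU by blast
    then show "P_fun u G y + \<epsilon> * exp (- \<alpha> * (norm (y - a))\<^sup>2) \<le> M + \<epsilon> * C"
    proof cases
      case 1
      then show ?thesis using le[of y] by (simp add: C_def dist_norm norm_minus_commute)
    next
      case 2
      have "exp (- \<alpha> * (norm (y - a))\<^sup>2) \<le> 1" using \<open>\<alpha> > 0\<close> by simp
      then have "\<epsilon> * exp (- \<alpha> * (norm (y - a))\<^sup>2) \<le> \<epsilon>"
        using \<open>\<epsilon> > 0\<close> by (simp add: mult_left_le)
      moreover have "P_fun u G y + \<epsilon> \<le> M" using m(2)[OF 2] by (simp add: \<epsilon>_def)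
      moreover have "\<epsilon> * C > 0" using \<open>\<epsilon> > 0\<close> \<open>C > 0\<close> by simp
      ultimately show ?thesis by linarith
    qed
  qed
  have gq: "g q = C" using q by (simp add: g_def C_def dist_norm norm_minus_commute)
  have "(g has_derivative (\<lambda>k. (- 2 * \<alpha> * g q) *\<^sub>R (q - a) \<bullet> k)) (at q)"
    using hess_on_gaussian[of \<alpha> a UNIV] unfolding hess_on_def g_def by blast
  then have "((\<lambda>x. P_fun u G x + \<epsilon> * g x) has_derivative
      (\<lambda>k. 0 + \<epsilon> * ((- 2 * \<alpha> * g q) *\<^sub>R (q - a) \<bullet> k))) (at (q + 0 *\<^sub>R (a - q)))"
    using der by (intro has_derivative_add has_derivative_mult_right) simp_all
  from has_real_derivative_along_line[OF this]
  have "((\<lambda>s. P_fun u G (q + s *\<^sub>R (a - q)) + \<epsilon> * g (q + s *\<^sub>R (a - q))) has_real_derivative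
      \<epsilon> * (2 * \<alpha> * C * r\<^sup>2)) (at 0)"
  proof -
    have "(q - a) \<bullet> (a - q) = - r\<^sup>2"
      using q by (simp add: dist_norm norm_minus_commute power2_norm_eq_inner[symmetric]
          minus_diff_eq[of a q, symmetric] del: minus_diff_eq)
    then show ?thesis
      using \<open>((\<lambda>s. P_fun u G (q + s *\<^sub>R (a - q)) + \<epsilon> * g (q + s *\<^sub>R (a - q))) has_real_derivative _) _\<close>
      by (simp add: gq)
  qed
  moreover have "0 < \<epsilon> * (2 * \<alpha> * C * r\<^sup>2)"
    using \<open>\<epsilon> > 0\<close> \<open>\<alpha> > 0\<close> \<open>C > 0\<close> \<open>r > 0\<close> by simp
  ultimately obtain d where "d > 0" and d: "\<And>s. 0 < s \<Longrightarrow> s < d \<Longrightarrow>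
      M + \<epsilon> * C < P_fun u G (q + s *\<^sub>R (a - q)) + \<epsilon> * g (q + s *\<^sub>R (a - q))"
    using DERIV_pos_inc_right q gq by fastforce
  \<comment> \<open>A step below 1/2 keeps the distance (1 - s) r from \<open>a\<close> above r/2,
    hence the point in the annulus.\<close>
  define s where "s = min d (1 / 2) / 2"
  have s: "0 < s" "s < d" "s < 1 / 2" using \<open>d > 0\<close> by (auto simp: s_def)
  have "dist a (q + s *\<^sub>R (a - q)) = (1 - s) * r"
  proof -
    have "a - (q + s *\<^sub>R (a - q)) = (1 - s) *\<^sub>R (a - q)" by (simp add: algebra_simps)
    then show ?thesis using s q by (simp add: dist_norm)
  qed
  then have "q + s *\<^sub>R (a - q) \<in> U"
    using s \<open>r > 0\<close> by (simp add: U_def)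
  from comp[OF this] d[OF s(1,2)] show False by simp
qed

section \<open>Sign and maximum of u, and the components of the complement of MAX(u)\<close>

lemma P_fun_has_derivative:
  assumes "serrin_solution \<Omega> u G" "x \<in> \<Omega>"
  shows "(P_fun u G has_derivative
           (\<lambda>h. 2 * (G x \<bullet> frechet_derivative G (at x) h) + 2 * (G x \<bullet> h))) (at x)"
proof -
  have "(u has_derivative (\<lambda>h. G x \<bullet> h)) (at x)"
    "(G has_derivative frechet_derivative G (at x)) (at x)"
    using serrin_solution_hess[OF assms(1)] assms(2) by (auto simp: hess_on_def)
  then show ?thesis
    unfolding P_fun_def[abs_def] power2_norm_eq_inner
    by (auto intro!: derivative_eq_intros simp: inner_commute)
qed

text \<open>A local minimum of \<open>u\<close> is a maximum of \<open>-u\<close>, whose Hessian has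
  trace n > 0.\<close>

lemma serrin_solution_no_min:
  fixes u :: "'a::euclidean_space \<Rightarrow> real"
  assumes sol: "serrin_solution \<Omega> u G" and "open S" "S \<subseteq> \<Omega>" "x \<in> S"
  shows "\<exists>y\<in>S. u y < u x"
proof (rule ccontr)
  assume "\<not> ?thesis"
  then have "\<And>y. y \<in> S \<Longrightarrow> (- 1) * u y \<le> (- 1) * u x" by force
  from op_trace_hess_at_max[OF hess_on_cmult[OF hess_on_subset[OF serrin_solution_hess[OF sol]
        \<open>S \<subseteq> \<Omega>\<close>]] \<open>open S\<close> \<open>x \<in> S\<close> this]
  have "(- 1) * op_trace (frechet_derivative G (at x)) \<le> 0"
    by (simp only: op_trace_scaleR)
  moreover have "op_trace (frechet_derivative G (at x)) = - real DIM('a)"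
    using serrin_solution_trace[OF sol] assms by blast
  ultimately show False by simp
qed

lemma serrin_solution_pos:
  assumes sol: "serrin_solution \<Omega> u G" and "open \<Omega>" "bounded \<Omega>" "x \<in> \<Omega>"
  shows "u x > 0"
proof -
  have "compact (closure \<Omega>)" "closure \<Omega> \<noteq> {}" "continuous_on (closure \<Omega>) u"
    using assms by (auto simp: serrin_solution_def compact_closure)
  then obtain y where y: "y \<in> closure \<Omega>" "\<And>z. z \<in> closure \<Omega> \<Longrightarrow> u y \<le> u z"
    using continuous_attains_inf[of "closure \<Omega>" u] by blast
  \<comment> \<open>Comparing the minimum over the closure with a value below \<open>u x\<close>
    makes the resulting inequality strict at \<open>x\<close>.\<close>
  obtain z where z: "z \<in> \<Omega>" "u z < u x"
    using serrin_solution_no_min[OF sol \<open>open \<Omega>\<close> order_refl \<open>x \<in> \<Omega>\<close>] by blast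
  have "y \<notin> \<Omega>"
    using serrin_solution_no_min[OF sol \<open>open \<Omega>\<close> order_refl, of y] y(2) closure_subset
    by (meson leD subsetD)
  then have "u y = 0"
    using sol y \<open>open \<Omega>\<close> by (simp add: serrin_solution_def frontier_def interior_open)
  moreover have "u y \<le> u z" using y z closure_subset by blast
  ultimately show ?thesis using z by linarith
qed

lemma serrin_solution_umax:
  assumes sol: "serrin_solution \<Omega> u G" and "open \<Omega>" "bounded \<Omega>" "\<Omega> \<noteq> {}"
  shows "MAXset \<Omega> u \<noteq> {}" "\<And>x. x \<in> \<Omega> \<Longrightarrow> u x \<le> umax \<Omega> u" "umax \<Omega> u > 0"
proof -
  have "compact (closure \<Omega>)" "closure \<Omega> \<noteq> {}" "continuous_on (closure \<Omega>) u"
    using assms by (auto simp: serrin_solution_def compact_closure)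
  then obtain y where y: "y \<in> closure \<Omega>" "\<And>z. z \<in> closure \<Omega> \<Longrightarrow> u z \<le> u y"
    using continuous_attains_sup[of "closure \<Omega>" u] by blast
  have "y \<in> \<Omega>"
  proof (rule ccontr)
    assume "y \<notin> \<Omega>"
    then have "u y = 0"
      using sol y \<open>open \<Omega>\<close> by (simp add: serrin_solution_def frontier_def interior_open)
    then show False
      using serrin_solution_pos[OF sol \<open>open \<Omega>\<close> \<open>bounded \<Omega>\<close>] y(2) \<open>\<Omega> \<noteq> {}\<close> closure_subset
      by (metis all_not_in_conv leD subsetD)
  qed
  then have "umax \<Omega> u = u y"
    unfolding umax_def using y(2) closure_subset by (intro cSup_eq_maximum) auto
  then show "MAXset \<Omega> u \<noteq> {}" "\<And>x. x \<in> \<Omega> \<Longrightarrow> u x \<le> umax \<Omega> u" "umax \<Omega> u > 0"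
    using y(2) closure_subset \<open>y \<in> \<Omega>\<close> serrin_solution_pos[OF sol \<open>open \<Omega>\<close> \<open>bounded \<Omega>\<close>]
    by (auto simp: MAXset_def)
qed

lemma serrin_solution_gradient_MAXset:
  assumes sol: "serrin_solution \<Omega> u G" and "open \<Omega>" "bounded \<Omega>" "x \<in> MAXset \<Omega> u"
  shows "G x = 0"
proof -
  have x: "x \<in> \<Omega>" "\<And>y. y \<in> \<Omega> \<Longrightarrow> u y \<le> u x"
    using serrin_solution_umax(2)[OF sol] assms by (auto simp: MAXset_def)
  then have "(u has_derivative (\<lambda>h. G x \<bullet> h)) (at x)"
    using sol by (simp add: serrin_solution_def)
  then have "(\<lambda>h. G x \<bullet> h) = (\<lambda>h. 0)"
    using differential_zero_maxmin[OF \<open>x \<in> \<Omega>\<close> \<open>open \<Omega>\<close>] x by blast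
  then have "G x \<bullet> G x = 0" by meson
  then show ?thesis by simp
qed

text \<open>The last claim holds because a component is relatively closed in \<Omega> minus MAX(u):
  a limit point of \<open>N\<close> in \<Omega> outside MAX(u) would belong to the open set
  \<open>N\<close> itself.\<close>

lemma MAXset_component:
  assumes sol: "serrin_solution \<Omega> u G" and "open \<Omega>"
    and N: "N \<in> components (\<Omega> - MAXset \<Omega> u)"
  shows "open N" "N \<subseteq> \<Omega> - MAXset \<Omega> u" "connected N" "N \<noteq> {}"
    "frontier N \<inter> \<Omega> \<subseteq> MAXset \<Omega> u"
proof -
  have cu: "continuous_on \<Omega> u"
    using sol closure_subset unfolding serrin_solution_def by (blast intro: continuous_on_subset)
  have "\<Omega> - MAXset \<Omega> u = \<Omega> \<inter> u -` (- {umax \<Omega> u})"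
    by (auto simp: MAXset_def)
  also have "open \<dots>"
    by (rule continuous_open_preimage[OF cu \<open>open \<Omega>\<close>]) auto
  finally have "open (\<Omega> - MAXset \<Omega> u)" .
  then show "open N" using N open_components by blast
  show "N \<subseteq> \<Omega> - MAXset \<Omega> u" "connected N" "N \<noteq> {}"
    using N in_components_subset in_components_connected in_components_nonempty by blast+
  show "frontier N \<inter> \<Omega> \<subseteq> MAXset \<Omega> u"
  proof
    fix q assume q: "q \<in> frontier N \<inter> \<Omega>"
    then have "q \<in> closure N" "q \<notin> N"
      using \<open>open N\<close> by (auto simp: frontier_def interior_open)
    moreover obtain T where "closed T" "N = (\<Omega> - MAXset \<Omega> u) \<inter> T"
      using closedin_component[OF N] by (auto simp: closedin_closed)
    moreover have "closure N \<subseteq> T" using calculation by (intro closure_minimal) auto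
    ultimately show "q \<in> MAXset \<Omega> u" using q by blast
  qed
qed

text \<open>Otherwise \<open>u\<close> would attain its minimum over the closure of \<open>N\<close>
  on the part of the frontier inside MAX(u), although it is below its maximum in \<open>N\<close>.
  This makes the supremum in \<open>tau_region\<close> range over a nonempty family.\<close>

lemma MAXset_component_frontier:
  assumes sol: "serrin_solution \<Omega> u G" and \<Omega>: "open \<Omega>" "bounded \<Omega>"
    and N: "N \<in> components (\<Omega> - MAXset \<Omega> u)"
  shows "frontier \<Omega> \<inter> closure N \<noteq> {}"
proof
  assume empty: "frontier \<Omega> \<inter> closure N = {}"
  note Np = MAXset_component[OF sol \<Omega>(1) N]
  have "\<Omega> \<noteq> {}" using Np by blast
  have clN: "closure N \<subseteq> closure \<Omega>" using Np by (intro closure_mono) blast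
  have "bounded N" using Np \<Omega> by (blast intro: bounded_subset)
  then have "compact (closure N)" "closure N \<noteq> {}" "continuous_on (closure N) u"
    using sol clN Np by (auto simp: serrin_solution_def compact_closure intro: continuous_on_subset)
  then obtain y where y: "y \<in> closure N" "\<And>z. z \<in> closure N \<Longrightarrow> u y \<le> u z"
    using continuous_attains_inf[of "closure N" u] by blast
  have "y \<notin> N"
    using serrin_solution_no_min[OF sol \<open>open N\<close>, of y] y(2) closure_subset Np
    by (meson Diff_subset leD order_trans subsetD)
  moreover have "y \<in> \<Omega>"
    using y clN empty \<Omega> by (auto simp: frontier_def interior_open)
  ultimately have "y \<in> MAXset \<Omega> u"
    using y Np by (auto simp: frontier_def interior_open)
  obtain x where "x \<in> N" using Np by blast
  then have "u x < umax \<Omega> u"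
    using Np serrin_solution_umax(2)[OF sol \<Omega> \<open>\<Omega> \<noteq> {}\<close>, of x] by (force simp: MAXset_def)
  then show False
    using y(2)[of x] \<open>x \<in> N\<close> \<open>y \<in> MAXset \<Omega> u\<close> closure_subset by (force simp: MAXset_def)
qed

section \<open>Constancy of the P-function on N\<close>

lemma P_fun_constant:
  assumes sol: "serrin_solution \<Omega> u G" and \<Omega>: "open \<Omega>" "bounded \<Omega>" "connected \<Omega>"
    and N: "N \<in> components (\<Omega> - MAXset \<Omega> u)"
    and bound: "\<And>x. x \<in> frontier \<Omega> \<inter> closure N \<Longrightarrow> P_fun u G x \<le> 2 * umax \<Omega> u"
    and "x \<in> N"
  shows "P_fun u G x = 2 * umax \<Omega> u"
proof (rule ccontr)
  assume neq: "P_fun u G x \<noteq> 2 * umax \<Omega> u"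
  define M where "M = 2 * umax \<Omega> u"
  define V where "V = {x \<in> N. P_fun u G x < M}"
  note Np = MAXset_component[OF sol \<Omega>(1) N]
  have N\<Omega>: "N \<subseteq> \<Omega>" using Np by blast
  have "\<Omega> \<noteq> {}" using Np by blast
  have PMAX: "P_fun u G q = M" if "q \<in> MAXset \<Omega> u" for q
    using serrin_solution_gradient_MAXset[OF sol \<Omega>(1,2) that] that
    by (simp add: P_fun_def M_def MAXset_def)
  \<comment> \<open>The frontier of \<open>N\<close> splits into a part on the boundary of \<Omega>,
    covered by \<open>bound\<close>, and a part in MAX(u), where P equals M.\<close>
  have PleN: "P_fun u G z \<le> M" if "z \<in> N" for z
  proof (rule P_fun_weak_maximum_principle[OF sol \<open>open N\<close> _ N\<Omega> _ that])
    show "bounded N" using N\<Omega> \<Omega> bounded_subset by blast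
    fix y assume y: "y \<in> frontier N"
    then have "y \<in> closure N" by (simp add: frontier_def)
    then have "y \<in> \<Omega> \<or> y \<in> frontier \<Omega>"
      using closure_mono[OF N\<Omega>] \<Omega> by (auto simp: frontier_def interior_open)
    then show "P_fun u G y \<le> M"
      using bound[of y] PMAX[of y] Np y \<open>y \<in> closure N\<close> by (auto simp: M_def)
  qed
  have contP: "continuous_on N (P_fun u G)"
    using P_fun_continuous[OF sol] N\<Omega> closure_subset by (blast intro: continuous_on_subset)
  have "V = N \<inter> P_fun u G -` {..<M}" by (auto simp: V_def)
  then have "open V"
    using continuous_open_preimage[OF contP \<open>open N\<close>, of "{..<M}"] by simp
  have "x \<in> V" using neq PleN[OF \<open>x \<in> N\<close>] \<open>x \<in> N\<close> by (simp add: V_def M_def)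
  obtain p where p: "p \<in> MAXset \<Omega> u"
    using serrin_solution_umax(1)[OF sol \<Omega>(1,2) \<open>\<Omega> \<noteq> {}\<close>] by blast
  \<comment> \<open>\<Omega> is connected, and V is nonempty but misses MAX(u), so the frontier of V
    enters \<Omega>.\<close>
  have "\<Omega> \<inter> frontier V \<noteq> {}"
  proof (rule connected_Int_frontier[OF \<open>connected \<Omega>\<close>])
    show "\<Omega> \<inter> V \<noteq> {}" using \<open>x \<in> V\<close> \<open>x \<in> N\<close> N\<Omega> by blast
    show "\<Omega> - V \<noteq> {}" using p Np by (auto simp: V_def MAXset_def)
  qed
  then obtain q0 where q0: "q0 \<in> \<Omega>" "q0 \<in> frontier V" by blast
  \<comment> \<open>Starting from \<open>a\<close> within e/2 of \<open>q0\<close>, the nearest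
    point \<open>q\<close> outside V is also within e/2 of \<open>a\<close>. Hence the closed ball
    around \<open>a\<close> through \<open>q\<close> stays in \<Omega>, its interior lies in V, and
    it is an interior touching ball at \<open>q\<close>.\<close>
  obtain e where "e > 0" and e: "ball q0 e \<subseteq> \<Omega>"
    using \<open>open \<Omega>\<close> q0 open_contains_ball by blast
  have "q0 \<in> closure V" "q0 \<notin> V"
    using q0 \<open>open V\<close> by (auto simp: frontier_def interior_open)
  then obtain a where a: "a \<in> V" "dist a q0 < e / 2"
    using \<open>e > 0\<close> closure_approachable[of q0 V] by (meson half_gt_zero)
  have "closed (- V)" using \<open>open V\<close> by (simp add: closed_Compl)
  then obtain q where q: "q \<in> - V" "\<And>y. y \<in> - V \<Longrightarrow> dist a q \<le> dist a y"
    using distance_attains_inf[of "- V" a] \<open>q0 \<notin> V\<close> by blast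
  define r where "r = dist a q"
  have "r > 0" using q a by (auto simp: r_def)
  have "r < e / 2" using q(2)[of q0] \<open>q0 \<notin> V\<close> a by (simp add: r_def)
  have ballV: "ball a r \<subseteq> V"
    using q(2) by (force simp: r_def)
  have cball\<Omega>: "cball a r \<subseteq> \<Omega>"
  proof (rule subset_trans[OF _ e], rule subsetI)
    fix y assume "y \<in> cball a r"
    then show "y \<in> ball q0 e"
      using dist_triangle[of q0 y a] a \<open>r < e / 2\<close> by (simp add: dist_commute)
  qed
  have q\<Omega>: "q \<in> \<Omega>" using cball\<Omega> by (auto simp: r_def)
  have "q \<in> closure V"
    using closure_mono[OF ballV] \<open>r > 0\<close> by (auto simp: r_def)
  then have "q \<in> closure N" using closure_mono[of V N] by (auto simp: V_def)
  \<comment> \<open>Inside \<open>N\<close> the point is a maximum of P; in MAX(u) the gradient of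
    \<open>u\<close> is zero, and it is a factor of the derivative of P.\<close>
  have "P_fun u G q = M \<and> (P_fun u G has_derivative (\<lambda>h. 0)) (at q)"
  proof (cases "q \<in> N")
    case True
    then have "P_fun u G q = M" using q PleN[of q] by (force simp: V_def)
    moreover have "(\<lambda>h. 2 * (G q \<bullet> frechet_derivative G (at q) h) + 2 * (G q \<bullet> h)) = (\<lambda>h. 0)"
      using differential_zero_maxmin[OF True \<open>open N\<close> P_fun_has_derivative[OF sol q\<Omega>]] PleN
        \<open>P_fun u G q = M\<close> by blast
    ultimately show ?thesis using P_fun_has_derivative[OF sol q\<Omega>] by simp
  next
    case False
    then have "q \<in> MAXset \<Omega> u"
      using \<open>q \<in> closure N\<close> q\<Omega> Np by (auto simp: frontier_def interior_open)
    then show ?thesis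
      using PMAX[of q] serrin_solution_gradient_MAXset[OF sol \<Omega>(1,2), of q]
        P_fun_has_derivative[OF sol q\<Omega>] by simp
  qed
  moreover have "P_fun u G z < M" if "z \<in> ball a r" for z
    using ballV that unfolding V_def by blast
  ultimately show False
    using P_fun_hopf[OF sol cball\<Omega> \<open>r > 0\<close> _ r_def[symmetric]] by blast
qed

section \<open>From constant P to a quadratic profile and a ball\<close>

lemma zero_derivative_constant_on:
  fixes f :: "'a::euclidean_space \<Rightarrow> 'b::banach"
  assumes "connected S" "open S" "\<And>x. x \<in> S \<Longrightarrow> (f has_derivative (\<lambda>h. 0)) (at x)"
  shows "f constant_on S"
proof (rule has_derivative_zero_connected_constant_on[OF assms(1,2), of "{}"])
  show "continuous_on S f"
    using assms(3) by (meson continuous_at_imp_continuous_on has_derivative_continuous)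
qed (use assms(3) in \<open>auto intro: has_derivative_at_withinI\<close>)

text \<open>Where P is constant every point is a maximum, so the touching inequality with test
  function 0 forces D^2u = -I. Two integrations on the connected set \<open>N\<close> give G = c - x
  and then the quadratic, up to a constant.\<close>

lemma P_fun_constant_imp_quadratic:
  fixes u :: "'a::euclidean_space \<Rightarrow> real"
  assumes sol: "serrin_solution \<Omega> u G" and N: "open N" "connected N" "N \<subseteq> \<Omega>"
    and const: "\<And>x. x \<in> N \<Longrightarrow> P_fun u G x = 2 * m"
  obtains c where "\<And>x. x \<in> N \<Longrightarrow> u x = m - (norm (x - c))\<^sup>2 / 2"
proof (cases "N = {}")
  case True
  then show ?thesis using that by blast
next
  case False
  have der: "(G has_derivative uminus) (at x)" if "x \<in> N" for x
  proof -
    let ?D = "frechet_derivative G (at x)"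
    obtain R where R: "R > 0" "ball x R \<subseteq> N"
      using N \<open>x \<in> N\<close> open_contains_ball by blast
    have "op_trace (\<lambda>k::'a. 0) + 2 * (\<Sum>b\<in>Basis. (norm (?D b + b))\<^sup>2) \<le> 0"
    proof (rule P_fun_touching[OF sol _ R(1)])
      show "ball x R \<subseteq> \<Omega>" using R N by blast
      show "hess_on (\<lambda>x. 0) (\<lambda>x. 0) (\<lambda>x k. 0) (ball x R)" by (simp add: hess_on_def)
      show "P_fun u G y + 0 \<le> P_fun u G x + 0" if "y \<in> ball x R" for y
        using R that const \<open>x \<in> N\<close> by (metis order_refl subsetD)
    qed simp
    then have "(\<Sum>b\<in>Basis. (norm (?D b + b))\<^sup>2) = 0"
      by (simp add: op_trace_def sum_nonneg antisym)
    then have D: "?D b = - b" if "b \<in> Basis" for b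
      using that by (simp add: sum_nonneg_eq_0_iff eq_neg_iff_add_eq_0)
    have G': "(G has_derivative ?D) (at x)"
      using serrin_solution_hess[OF sol] that N by (auto simp: hess_on_def)
    have "?D h = - h" for h
      using linear_eq_stdbasis[OF has_derivative_linear[OF G'], of uminus] D
      by (simp add: linear_uminus module_hom_uminus fun_eq_iff)
    then have "?D = uminus" by (simp add: fun_eq_iff)
    then show ?thesis using G' by simp
  qed
  have "((\<lambda>x. G x + x) has_derivative (\<lambda>h. 0)) (at x)" if "x \<in> N" for x
    using has_derivative_add[OF der[OF that] has_derivative_ident] by simp
  then have "(\<lambda>x. G x + x) constant_on N"
    using N by (intro zero_derivative_constant_on) auto
  then obtain c where "\<And>x. x \<in> N \<Longrightarrow> G x + x = c" by (auto simp: constant_on_def)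
  then have c: "G x = c - x" if "x \<in> N" for x using that by (simp add: algebra_simps)
  have "((\<lambda>x. u x + (1 / 2) * (norm (x - c))\<^sup>2) has_derivative (\<lambda>h. 0)) (at x)" if "x \<in> N" for x
  proof -
    have "(u has_derivative (\<lambda>h. (c - x) \<bullet> h)) (at x)"
      using serrin_solution_hess[OF sol] that N c[OF that] by (force simp: hess_on_def)
    moreover have "((\<lambda>x. (norm (x - c))\<^sup>2) has_derivative (\<lambda>h. 2 *\<^sub>R (x - c) \<bullet> h)) (at x)"
      using hess_on_norm_square[of c UNIV] by (simp add: hess_on_def)
    ultimately have "((\<lambda>x. u x + (1 / 2) * (norm (x - c))\<^sup>2) has_derivative
        (\<lambda>h. (c - x) \<bullet> h + (1 / 2) * (2 *\<^sub>R (x - c) \<bullet> h))) (at x)"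
      by (intro has_derivative_add has_derivative_mult_right)
    moreover have "(c - x) \<bullet> h + (1 / 2) * (2 *\<^sub>R (x - c) \<bullet> h) = 0" for h
      using inner_minus_left[of "x - c" h] by simp
    ultimately show ?thesis by (simp only:)
  qed
  then have "(\<lambda>x. u x + (1 / 2) * (norm (x - c))\<^sup>2) constant_on N"
    using N by (intro zero_derivative_constant_on) auto
  then obtain k where "\<And>x. x \<in> N \<Longrightarrow> u x + (norm (x - c))\<^sup>2 / 2 = k"
    by (auto simp: constant_on_def)
  then have k: "u x = k - (norm (x - c))\<^sup>2 / 2" if "x \<in> N" for x using that by (simp add: algebra_simps)
  \<comment> \<open>One point fixes the constant: there P = |z - c|^2 + 2 k - |z - c|^2 = 2
    k.\<close>
  obtain z where "z \<in> N" using False by blast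
  then have "k = m"
    using const[of z] k[of z] c[of z] by (simp add: P_fun_def norm_minus_commute)
  then show ?thesis using that k by blast
qed

lemma affine_image_unit_ball:
  fixes c :: "'a::real_normed_vector"
  assumes "l > 0"
  shows "(\<lambda>x. l *\<^sub>R x + c) ` ball 0 1 = ball c l"
proof (intro equalityI subsetI)
  fix y assume "y \<in> ball c l"
  then have "y = l *\<^sub>R ((1 / l) *\<^sub>R (y - c)) + c" "(1 / l) *\<^sub>R (y - c) \<in> ball 0 1"
    using assms by (auto simp: dist_norm norm_minus_commute)
  then show "y \<in> (\<lambda>x. l *\<^sub>R x + c) ` ball 0 1" by blast
qed (use assms in \<open>auto simp: dist_norm\<close>)

lemma scaled_serrin_profile:
  fixes z :: "'a::real_normed_vector"
  assumes "l > 0"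
  shows "l\<^sup>2 * ((1 - (norm ((1 / l) *\<^sub>R z))\<^sup>2) / 2) = (l\<^sup>2 - (norm z)\<^sup>2) / 2"
  using assms by (simp add: power_divide right_diff_distrib)

text \<open>Frontier points of \<open>N\<close> inside \<Omega> have u = \<open>umax\<close>, and
  the quadratic takes this value only at \<open>c\<close>. In dimension at least 2 the set \<Omega>
  minus \<open>c\<close> is still connected, so it equals \<open>N\<close> and the quadratic formula
  extends to the closure of \<Omega>. Positivity in \<Omega> and the boundary values then identify
  \<Omega> as a ball.\<close>

lemma quadratic_on_component_imp_equiv_serrin:
  fixes u :: "'a::euclidean_space \<Rightarrow> real"
  assumes "DIM('a) \<ge> 2" and sol: "serrin_solution \<Omega> u G"
    and \<Omega>: "open \<Omega>" "bounded \<Omega>" "connected \<Omega>"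
    and N: "N \<in> components (\<Omega> - MAXset \<Omega> u)"
    and quad: "\<And>x. x \<in> N \<Longrightarrow> u x = umax \<Omega> u - (norm (x - c))\<^sup>2 / 2"
  shows "equiv_serrin \<Omega> u"
proof -
  let ?m = "umax \<Omega> u"
  note Np = MAXset_component[OF sol \<Omega>(1) N]
  have N\<Omega>: "N \<subseteq> \<Omega>" and "\<Omega> \<noteq> {}" using Np by blast+
  note um = serrin_solution_umax[OF sol \<Omega>(1,2) \<open>\<Omega> \<noteq> {}\<close>]
  have contu: "continuous_on (closure \<Omega>) u" using sol by (simp add: serrin_solution_def)
  have quad': "u x = ?m - (norm (x - c))\<^sup>2 / 2" if "x \<in> closure N" for x
  proof -
    have "continuous_on (closure N) (\<lambda>x. u x + (norm (x - c))\<^sup>2 / 2)"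
      by (intro continuous_intros continuous_on_subset[OF contu] closure_mono N\<Omega>) auto
    then have "u x + (norm (x - c))\<^sup>2 / 2 = ?m"
      by (rule continuous_constant_on_closure[OF _ _ that]) (simp add: quad)
    then show ?thesis by simp
  qed
  have fr: "frontier N \<inter> \<Omega> \<subseteq> {c}"
  proof
    fix q assume "q \<in> frontier N \<inter> \<Omega>"
    then have "u q = ?m" "q \<in> closure N" using Np(5) by (auto simp: MAXset_def frontier_def)
    then show "q \<in> {c}" using quad'[of q] by simp
  qed
  have "\<Omega> - N \<noteq> {}" using um(1) Np(2) by (auto simp: MAXset_def)
  then have "\<Omega> \<inter> frontier N \<noteq> {}"
    using connected_Int_frontier[OF \<Omega>(3), of N] N\<Omega> Np(4) by blast
  then have c: "c \<in> \<Omega>" "c \<in> frontier N" using fr by blast+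
  have "c \<notin> N" using c Np(1) by (simp add: frontier_def interior_open)
  have "connected (\<Omega> - {c})"
    using \<Omega> \<open>DIM('a) \<ge> 2\<close> by (intro connected_open_delete) auto
  then have "\<Omega> - {c} \<subseteq> N"
    using connected_Int_frontier[of "\<Omega> - {c}" N] fr N\<Omega> Np(4) \<open>c \<notin> N\<close> by blast
  moreover have "c \<in> closure N" using c by (simp add: frontier_def)
  ultimately have "\<Omega> \<subseteq> closure N" using closure_subset by blast
  then have cl: "closure \<Omega> \<subseteq> closure N" by (simp add: closure_minimal)
  \<comment> \<open>This is the radius at which the quadratic vanishes.\<close>
  define l where "l = sqrt (2 * ?m)"
  have l: "l > 0" "l\<^sup>2 = 2 * ?m" using um(3) by (auto simp: l_def)
  have uq: "u x = (l\<^sup>2 - (norm (x - c))\<^sup>2) / 2" if "x \<in> closure \<Omega>" for x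
    using quad'[of x] that cl l by (auto simp: field_simps)
  have "\<Omega> \<subseteq> ball c l"
  proof
    fix x assume "x \<in> \<Omega>"
    then have "(norm (x - c))\<^sup>2 < l\<^sup>2"
      using serrin_solution_pos[OF sol \<Omega>(1,2)] uq[of x] closure_subset by fastforce
    then show "x \<in> ball c l"
      using l power2_less_imp_less[of "norm (x - c)" l] by (simp add: dist_norm norm_minus_commute)
  qed
  \<comment> \<open>A boundary point inside the ball would be a zero of \<open>u\<close> at distance
    less than l from \<open>c\<close>.\<close>
  moreover have "ball c l \<subseteq> \<Omega>"
  proof (rule ccontr)
    assume "\<not> ball c l \<subseteq> \<Omega>"
    then have "ball c l \<inter> frontier \<Omega> \<noteq> {}"
      using connected_Int_frontier[OF connected_ball, of c l \<Omega>] c l centre_in_ball[of c l] by blast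
    then obtain x where x: "dist c x < l" "x \<in> frontier \<Omega>" by auto
    then have "u x = 0" "x \<in> closure \<Omega>" using sol by (auto simp: serrin_solution_def frontier_def)
    then have "(norm (x - c))\<^sup>2 = l\<^sup>2" using uq[of x] by simp
    then have "norm (x - c) = l" using l(1) by (simp add: power2_eq_iff_nonneg)
    then show False using x by (simp add: dist_norm norm_minus_commute)
  qed
  ultimately have eq: "\<Omega> = ball c l" by blast
  show ?thesis
    unfolding equiv_serrin_def
  proof (intro exI conjI ballI)
    show "\<Omega> = (\<lambda>x. l *\<^sub>R x + c) ` ball 0 1"
      unfolding eq affine_image_unit_ball[OF l(1)] ..
    fix y assume "y \<in> \<Omega>"
    then show "u y = l\<^sup>2 * ((1 - (norm ((1 / l) *\<^sub>R (y - c)))\<^sup>2) / 2)"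
      using uq[of y] closure_subset[of \<Omega>] scaled_serrin_profile[OF l(1), of "y - c"] by auto
  qed (use l in simp)
qed

section \<open>Values of tau and the equality case\<close>

text \<open>On the boundary u = 0, so P is |G|^2 there. Passing from \<open>tau_region\<close> to a
  single point goes through two real suprema, both bounded because \<open>G\<close> is continuous on
  a compact closure.\<close>

lemma tau_region_le_1_imp_gradient_bound:
  assumes sol: "serrin_solution \<Omega> u G" and \<Omega>: "open \<Omega>" "bounded \<Omega>" "\<Omega> \<noteq> {}"
    and tau: "tau_region \<Omega> u G N \<le> 1" and x: "x \<in> frontier \<Omega> \<inter> closure N"
  shows "P_fun u G x \<le> 2 * umax \<Omega> u"
proof -
  let ?F = "frontier \<Omega> \<inter> closure N" and ?s = "sqrt (2 * umax \<Omega> u)"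
  have "?s > 0" using serrin_solution_umax(3)[OF sol \<Omega>] by simp
  have "compact (closure \<Omega>)" "continuous_on (closure \<Omega>) (\<lambda>x. norm (G x))"
    using sol \<Omega> by (auto simp: serrin_solution_def compact_closure intro!: continuous_intros)
  then have "bdd_above ((\<lambda>x. norm (G x)) ` closure \<Omega>)"
    by (intro bounded_imp_bdd_above compact_imp_bounded compact_continuous_image)
  then obtain B where "\<And>y. y \<in> closure \<Omega> \<Longrightarrow> norm (G y) \<le> B"
    unfolding bdd_above_def by blast
  then have B: "norm (G y) \<le> B" if "y \<in> ?F" for y using that by (simp add: frontier_def)
  define S where "S = connected_component_set ?F x"
  have S: "S \<in> components ?F" "x \<in> S"
    using x by (auto simp: S_def components_def)
  have sub: "T \<subseteq> ?F" "T \<noteq> {}" if "T \<in> components ?F" for T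
    using that in_components_subset in_components_nonempty by blast+
  have "norm (G x) \<le> Sup ((\<lambda>x. norm (G x)) ` S)"
    using S sub[OF S(1)] B by (intro cSUP_upper bdd_aboveI2[of _ _ B]) auto
  then have "norm (G x) / ?s \<le> tau_comp \<Omega> u G S"
    unfolding tau_comp_def using \<open>?s > 0\<close> by (intro divide_right_mono) auto
  also have "\<dots> \<le> tau_region \<Omega> u G N"
    unfolding tau_region_def
  proof (rule cSUP_upper[OF S(1)])
    have "tau_comp \<Omega> u G T \<le> B / ?s" if "T \<in> components ?F" for T
      unfolding tau_comp_def using \<open>?s > 0\<close> sub[OF that] B
      by (intro divide_right_mono cSUP_least) auto
    then show "bdd_above (tau_comp \<Omega> u G ` components ?F)" by (intro bdd_aboveI2)
  qed
  also note tau
  finally have "norm (G x) \<le> ?s" using \<open>?s > 0\<close> by (simp add: pos_divide_le_eq)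
  then have "(norm (G x))\<^sup>2 \<le> ?s\<^sup>2" by (intro power_mono) auto
  moreover have "u x = 0" using sol x by (simp add: serrin_solution_def)
  ultimately show ?thesis using \<open>?s > 0\<close> by (simp add: P_fun_def)
qed

text \<open>The explicit form of \<open>u\<close> determines G = c - y in \<Omega> by uniqueness of
  derivatives and on the boundary by continuity. Hence |G| is constantly l = sqrt (2
  \<open>umax\<close>) there, and every boundary component has tau equal to 1.\<close>

lemma equiv_serrin_imp_tau_region:
  assumes sol: "serrin_solution \<Omega> u G" and \<Omega>: "open \<Omega>" "bounded \<Omega>" "\<Omega> \<noteq> {}"
    and N: "N \<in> components (\<Omega> - MAXset \<Omega> u)" and eq: "equiv_serrin \<Omega> u"
  shows "tau_region \<Omega> u G N = 1"
proof -
  obtain l c where l: "l > 0" and im: "\<Omega> = (\<lambda>x. l *\<^sub>R x + c) ` ball 0 1"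
    and u: "\<And>y. y \<in> \<Omega> \<Longrightarrow> u y = l\<^sup>2 * ((1 - (norm ((1 / l) *\<^sub>R (y - c)))\<^sup>2) / 2)"
    using eq unfolding equiv_serrin_def by blast
  have ball: "\<Omega> = ball c l"
    using affine_image_unit_ball[OF l] im by simp
  have u': "u y = l\<^sup>2 / 2 + (- 1 / 2) * (norm (y - c))\<^sup>2" if "y \<in> \<Omega>" for y
    using u[OF that] scaled_serrin_profile[OF l, of "y - c"] by (simp add: diff_divide_distrib)
  obtain p where p: "p \<in> \<Omega>" "u p = umax \<Omega> u"
    using serrin_solution_umax(1)[OF sol \<Omega>] by (auto simp: MAXset_def)
  have "c \<in> \<Omega>" using l ball by simp
  then have "l\<^sup>2 / 2 \<le> umax \<Omega> u"
    using serrin_solution_umax(2)[OF sol \<Omega>, of c] u'[of c] by simp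
  moreover have "umax \<Omega> u \<le> l\<^sup>2 / 2"
    unfolding p(2)[symmetric] u'[OF p(1)] by simp
  ultimately have um: "2 * umax \<Omega> u = l\<^sup>2" by linarith
  have "G y + (y - c) = 0" if "y \<in> \<Omega>" for y
  proof -
    have "((\<lambda>y. (norm (y - c))\<^sup>2) has_derivative (\<lambda>h. 2 *\<^sub>R (y - c) \<bullet> h)) (at y)"
      using hess_on_norm_square[of c UNIV] by (simp add: hess_on_def)
    then have "((\<lambda>y. l\<^sup>2 / 2 + (- 1 / 2) * (norm (y - c))\<^sup>2) has_derivative
        (\<lambda>h. 0 + (- 1 / 2) * (2 *\<^sub>R (y - c) \<bullet> h))) (at y)"
      by (intro has_derivative_add has_derivative_mult_right has_derivative_const)
    then have "(u has_derivative (\<lambda>h. 0 + (- 1 / 2) * (2 *\<^sub>R (y - c) \<bullet> h))) (at y)"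
      by (rule has_derivative_transform_within_open[OF _ \<Omega>(1) that]) (simp add: u')
    moreover have "(u has_derivative (\<lambda>h. G y \<bullet> h)) (at y)"
      using sol that by (simp add: serrin_solution_def)
    ultimately have "(\<lambda>h. G y \<bullet> h) = (\<lambda>h. 0 + (- 1 / 2) * (2 *\<^sub>R (y - c) \<bullet> h))"
      using has_derivative_unique by blast
    then have "G y \<bullet> h = - ((y - c) \<bullet> h)" for h
      using fun_cong[of "\<lambda>h. G y \<bullet> h" _ h] by simp
    then have "(G y + (y - c)) \<bullet> (G y + (y - c)) = 0"
      by (metis add.right_inverse inner_add_left add.commute)
    then show ?thesis by simp
  qed
  moreover have "continuous_on (closure \<Omega>) (\<lambda>y. G y + (y - c))"
    using sol by (auto simp: serrin_solution_def intro!: continuous_intros)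
  ultimately have "G y + (y - c) = 0" if "y \<in> closure \<Omega>" for y
    using continuous_constant_on_closure[of \<Omega> "\<lambda>y. G y + (y - c)" 0 y] that by blast
  then have "norm (G y) = norm (y - c)" if "y \<in> closure \<Omega>" for y
    using that by (metis add_eq_0_iff norm_minus_cancel)
  then have normG: "norm (G y) = l" if "y \<in> frontier \<Omega>" for y
    using that l ball by (auto simp: frontier_def dist_norm norm_minus_commute)
  have tau1: "tau_comp \<Omega> u G S = 1" if "S \<in> components (frontier \<Omega> \<inter> closure N)" for S
  proof -
    have "S \<subseteq> frontier \<Omega>" "S \<noteq> {}"
      using that in_components_subset in_components_nonempty by blast+
    then have "(\<lambda>x. norm (G x)) ` S = {l}" using normG by auto
    then show ?thesis using l um by (simp add: tau_comp_def)
  qed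
  obtain S where S: "S \<in> components (frontier \<Omega> \<inter> closure N)"
    using MAXset_component_frontier[OF sol \<Omega>(1,2) N] components_eq_empty by blast
  have "tau_comp \<Omega> u G ` components (frontier \<Omega> \<inter> closure N)
      = (\<lambda>_. 1) ` components (frontier \<Omega> \<inter> closure N)"
    using tau1 by (rule image_cong[OF refl])
  also have "\<dots> = {1}" using S by (rule image_constant)
  finally show ?thesis by (simp add: tau_region_def)
qed

theorem theorem3p3:
  fixes \<Omega> :: "'a::euclidean_space set" and u :: "'a \<Rightarrow> real" and G :: "'a \<Rightarrow> 'a"
    and N :: "'a set"
  assumes "DIM('a) \<ge> 3"
    and "smooth_bounded_domain \<Omega>"
    and "serrin_solution \<Omega> u G"
    and "N \<in> components (\<Omega> - MAXset \<Omega> u)"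
  shows "tau_region \<Omega> u G N \<ge> 1 \<and> (tau_region \<Omega> u G N = 1 \<longleftrightarrow> equiv_serrin \<Omega> u)"
proof -
  note sol = assms(3) and N = assms(4)
  have \<Omega>: "open \<Omega>" "bounded \<Omega>" "connected \<Omega>" "\<Omega> \<noteq> {}"
    using assms(2) by (auto simp: smooth_bounded_domain_def)
  note Np = MAXset_component[OF sol \<Omega>(1) N]
  \<comment> \<open>Assuming only tau at most 1 handles the bound as well: tau < 1 would give
    equivalence, and equivalence gives tau = 1.\<close>
  have "equiv_serrin \<Omega> u" if tau: "tau_region \<Omega> u G N \<le> 1"
  proof -
    have "P_fun u G x = 2 * umax \<Omega> u" if "x \<in> N" for x
      using P_fun_constant[OF sol \<Omega>(1-3) N _ that]
        tau_region_le_1_imp_gradient_bound[OF sol \<Omega>(1,2,4) tau] by blast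
    then obtain c where "\<And>x. x \<in> N \<Longrightarrow> u x = umax \<Omega> u - (norm (x - c))\<^sup>2 / 2"
      using P_fun_constant_imp_quadratic[OF sol Np(1,3)] Np(2) by blast
    then show ?thesis
      using quadratic_on_component_imp_equiv_serrin[OF _ sol \<Omega>(1-3) N] assms(1) by simp
  qed
  moreover have "tau_region \<Omega> u G N = 1" if "equiv_serrin \<Omega> u"
    using equiv_serrin_imp_tau_region[OF sol \<Omega>(1,2,4) N that] .
  ultimately show ?thesis by linarith
qed

end
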